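(* For every integer $h\ge 2$ the following hold. (1) There exists an integer $N_h>0$ such that $a_h(n)\ge b_h(n)$ for all $n>N_h$. (2) There exists a constant $\gamma_h>1$ such that $a_h(n)/b_h(n)\to\gamma_h$ as $n\to\infty$.
   Context: A partition $\lambda=(\lambda_1\ge\lambda_2\ge\dots\ge\lambda_\ell>0)$ of $n$ is drawn as its Ferrers diagram: left-adjusted rows of boxes, with $\lambda_i$ boxes in row $i$. The hook number of the box in row $i$ and column $j$ is the number of boxes in the L-shape consisting of that box, all boxes to its right in the same row, and all boxes below it in the same column. $\mathcal H(\lambda)$ denotes the multiset of all hook numbers of $\lambda$. Let $\mathcal O(n)$ be the set of partitions of $n$ all of whose parts are odd and $\mathcal D(n)$ the set of partitions of $n$ whose parts are pairwise distinct. For integers $h\ge1$ and $n\ge0$, define $$a_h(n)=\sum_{\lambda\in\mathcal O(n)}\#\{x\in\mathcal H(\lambda):x=h\},\qquad b_h(n)=\sum_{\lambda\in\mathcal D(n)}\#\{x\in\mathcal H(\lambda):x=h\},$$ counted with multiplicity. *)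

theory Defs
  imports Complex_Main "HOL-Library.Multiset"
begin

definition partitions :: "nat \<Rightarrow> nat list set" where
  "partitions n = {la. sorted_wrt (\<ge>) la \<and> (\<forall>p\<in>set la. p > 0) \<and> sum_list la = n}"

definition odd_partitions :: "nat \<Rightarrow> nat list set" where
  "odd_partitions n = {la \<in> partitions n. \<forall>p\<in>set la. odd p}"

definition distinct_partitions :: "nat \<Rightarrow> nat list set" where
  "distinct_partitions n = {la \<in> partitions n. distinct la}"

(* Boxes are pairs (row, column), both counted from 0. *)
definition ferrers_diagram :: "nat list \<Rightarrow> (nat \<times> nat) set" where
  "ferrers_diagram la = {(i, j). i < length la \<and> j < la ! i}"

definition hook :: "nat list \<Rightarrow> nat \<times> nat \<Rightarrow> (nat \<times> nat) set" where
  "hook la = (\<lambda>(i, j). {(i', j') \<in> ferrers_diagram la.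
     (i' = i \<and> j' \<ge> j) \<or> (j' = j \<and> i' \<ge> i)})"

definition hook_numbers :: "nat list \<Rightarrow> nat multiset" where
  "hook_numbers la = image_mset (\<lambda>x. card (hook la x)) (mset_set (ferrers_diagram la))"

definition odd_hooks :: "nat \<Rightarrow> nat \<Rightarrow> nat" where
  "odd_hooks h n = (\<Sum>la\<in>odd_partitions n. count (hook_numbers la) h)"

definition distinct_hooks :: "nat \<Rightarrow> nat \<Rightarrow> nat" where
  "distinct_hooks h n = (\<Sum>la\<in>distinct_partitions n. count (hook_numbers la) h)"

(* Finiteness of the sets over which mset_set, card and sum are taken above;
   on infinite sets these operations would silently return 0 or the empty multiset. *)

lemma finite_ferrers_diagram: "finite (ferrers_diagram la)"
proof -
  have "ferrers_diagram la = Sigma {..<length la} (\<lambda>i. {..<la ! i})"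
    by (auto simp: ferrers_diagram_def)
  then show ?thesis by simp
qed

lemma finite_hook: "finite (hook la x)"
  by (rule finite_subset[OF _ finite_ferrers_diagram[of la]])
     (auto simp: hook_def split: prod.splits)

lemma length_le_sum_list:
  "(\<forall>p\<in>set la. p > 0) \<Longrightarrow> length la \<le> sum_list la" for la :: "nat list"
  by (induction la) auto

lemma finite_partitions: "finite (partitions n)"
proof (rule finite_subset)
  show "partitions n \<subseteq> {la. set la \<subseteq> {..n} \<and> length la \<le> n}"
    using length_le_sum_list by (auto simp: partitions_def intro: member_le_sum_list)
  show "finite {la. set la \<subseteq> {..n} \<and> length la \<le> n}"
    by (rule finite_lists_length_le) simp
qed

lemma finite_odd_partitions: "finite (odd_partitions n)"
  using finite_partitions[of n] by (simp add: odd_partitions_def)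

lemma finite_distinct_partitions: "finite (distinct_partitions n)"
  using finite_partitions[of n] by (simp add: distinct_partitions_def)

end

theory Submission
  imports Defs "HOL-Analysis.Analysis" "HOL-Computational_Algebra.Formal_Power_Series"
    "HOL-Real_Asymp.Real_Asymp"
begin

text \<open>
  Let \<open>q m\<close> be the number of partitions of \<open>m\<close> into odd parts, which by Euler is also the number of
  partitions into distinct parts, and \<open>S n = (\<Sum>j<n. q j)\<close>. A box with arm \<open>a\<close> in a row of length \<open>p\<close>
  has hook number \<open>h\<close> iff \<open>h - 1 - a\<close> of the rows below have length at least \<open>p - a\<close>. This only
  involves the parts in \<open>{p - a..p}\<close>, so removing them turns both hook counts into finite sums of
  expressions \<open>\<Sum>p. N (n - c p + d)\<close>, where \<open>N\<close> counts partitions that avoid a block of parts at \<open>p\<close>.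
  Inclusion-exclusion on the avoided parts reduces these to \<open>\<Sum>p. q (n - c p + d)\<close>, which is
  \<open>S n / c + O(q n)\<close> because \<open>q\<close> is monotone, and \<open>q n = o(S n)\<close> since almost all partitions into
  distinct parts have many parts. Hence both hook counts divided by \<open>S n\<close> converge, the odd one to
  \<open>\<Sum>a<h. 1 / (2 (h - a + a div 2)) \<ge> 4/7\<close> and the distinct one to an integral which is at most
  \<open>ln 2 - 1/8 < 4/7\<close>.
\<close>

section \<open>Partitions as sets and multisets\<close>

text \<open>No asymptotic formula for \<open>q\<close> is needed: both hook counts are compared with
  the same \<open>S n\<close>, and \<open>q n = o(S n)\<close> makes bounded shifts of the argument
  harmless. The two inclusion-exclusions differ in kind. In a multiset a forbidden part is taken out
  once and may still occur, so an odd avoiding count is a difference of counts with one part fewer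
  forbidden, and the process stops. In a set a part taken out is gone, so the same avoiding count
  returns at a larger multiple of \<open>p\<close>; the recurrence must be iterated and its tail
  estimated. Since the sum of \<open>q (n - c p)\<close> over \<open>p\<close>, divided by
  \<open>S n\<close>, tends to \<open>1 / c\<close>, the integral of \<open>x ^ (c - 1)\<close> over
  the unit interval, forbidding a part multiplies the integrand by \<open>1 - x\<close> for odd
  parts and divides it by \<open>1 + x\<close> for distinct parts. The case \<open>h = 1\<close> is
  a true exception: its limits are \<open>1 / 2\<close> (odd) and \<open>ln 2\<close> (distinct).
  For \<open>h \<ge> 2\<close> the margin is thin: with \<open>ln 2 \<le> 25 / 36\<close> the two
  bounds differ by at least \<open>4 / 7 - 41 / 72 = 1 / 504\<close>.\<close>

definition distinct_count :: "nat set \<Rightarrow> int \<Rightarrow> nat" where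
  "distinct_count K m = card {A. finite A \<and> 0 \<notin> A \<and> A \<inter> K = {} \<and> int (\<Sum>A) = m}"

text \<open>The target is an integer because shifted targets such as
  \<open>int n - int c * int p + d\<close> may be negative, where both counts vanish. Truncated
  subtraction would send them to \<open>0\<close>, which the empty partition attains.\<close>

definition odd_count :: "nat set \<Rightarrow> int \<Rightarrow> nat" where
  "odd_count K m = card {M. (\<forall>x\<in>#M. odd x \<and> x \<notin> K) \<and> int (\<Sum>\<^sub># M) = m}"

lemma finite_distinct_sets:
  "finite {A :: nat set. finite A \<and> 0 \<notin> A \<and> int (\<Sum>A) = m \<and> P A}"
proof (rule finite_subset)
  show "{A :: nat set. finite A \<and> 0 \<notin> A \<and> int (\<Sum>A) = m \<and> P A} \<subseteq> Pow {..nat m}"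
  proof safe
    fix A :: "nat set" and x assume "finite A" "x \<in> A"
    then have "x \<le> \<Sum>A" using member_le_sum[of x A "\<lambda>x. x"] by simp
    then show "x \<le> nat (int (\<Sum>A))" by (metis nat_int)
  qed
qed simp

lemma mset_partitions:
  "mset ` partitions n = {M. 0 \<notin># M \<and> \<Sum>\<^sub># M = n}"
proof (intro set_eqI iffI)
  fix M :: "nat multiset" assume M: "M \<in> {M. 0 \<notin># M \<and> \<Sum>\<^sub># M = n}"
  define la where "la = rev (sorted_list_of_multiset M)"
  have m: "mset la = M" by (simp add: la_def)
  have s: "sorted_wrt (\<ge>) la" by (simp add: la_def sorted_wrt_rev)
  have "set la = set_mset M" using m by (metis set_mset_mset)
  then have "\<forall>p\<in>set la. p > 0" using M by (metis (mono_tags, lifting) mem_Collect_eq gr0I)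
  moreover have "sum_list la = n" using M m by (metis (mono_tags, lifting) mem_Collect_eq sum_mset_sum_list)
  ultimately have "la \<in> partitions n" using s by (simp add: partitions_def)
  then show "M \<in> mset ` partitions n" using m by blast
next
  fix M assume "M \<in> mset ` partitions n"
  then show "M \<in> {M. 0 \<notin># M \<and> \<Sum>\<^sub># M = n}"
    by (force simp: partitions_def sum_mset_sum_list)
qed

lemma inj_on_mset_partitions: "inj_on mset (partitions n)"
proof (rule inj_onI)
  fix x y assume "x \<in> partitions n" "y \<in> partitions n" "mset x = mset y"
  then have "sorted (rev x)" "sorted (rev y)" "mset (rev x) = mset (rev y)"
    by (simp_all add: partitions_def sorted_wrt_rev)
  then have "rev x = rev y" by (metis properties_for_sort)
  then show "x = y" by simp
qed

lemma zero_notin_odd_multiset: "\<forall>x\<in>#M. odd x \<Longrightarrow> 0 \<notin># M" for M :: "nat multiset"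
  by (metis even_zero)

lemma finite_odd_multisets:
  "finite {M :: nat multiset. (\<forall>x\<in>#M. odd x) \<and> int (\<Sum>\<^sub># M) = m \<and> P M}"
proof (rule finite_subset)
  show "{M :: nat multiset. (\<forall>x\<in>#M. odd x) \<and> int (\<Sum>\<^sub># M) = m \<and> P M} \<subseteq> mset ` partitions (nat m)"
    unfolding mset_partitions using zero_notin_odd_multiset by (auto simp del: of_nat_sum_mset)
qed (simp add: finite_partitions)

lemma bij_betw_odd_partitions:
  "bij_betw mset (odd_partitions n) {M. (\<forall>x\<in>#M. odd x) \<and> \<Sum>\<^sub># M = n}"
  unfolding bij_betw_def
proof
  show "inj_on mset (odd_partitions n)"
    by (rule inj_on_subset[OF inj_on_mset_partitions[of n]]) (auto simp: odd_partitions_def)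
  have "mset ` odd_partitions n = {M \<in> mset ` partitions n. \<forall>x\<in>#M. odd x}"
    by (auto simp: odd_partitions_def)
  also have "\<dots> = {M. (\<forall>x\<in>#M. odd x) \<and> \<Sum>\<^sub># M = n}"
    unfolding mset_partitions using zero_notin_odd_multiset by blast
  finally show "mset ` odd_partitions n = {M. (\<forall>x\<in>#M. odd x) \<and> \<Sum>\<^sub># M = n}" .
qed

lemma bij_betw_distinct_partitions:
  "bij_betw set (distinct_partitions n) {A. finite A \<and> 0 \<notin> A \<and> \<Sum>A = n}"
  unfolding bij_betw_def
proof
  show "inj_on set (distinct_partitions n)"
  proof (rule inj_onI)
    fix x y assume *: "x \<in> distinct_partitions n" "y \<in> distinct_partitions n" "set x = set y"
    then have "mset x = mset y"
      by (metis (mono_tags, lifting) distinct_partitions_def mem_Collect_eq mset_set_set)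
    then show "x = y" using * inj_on_mset_partitions[of n]
      by (simp add: distinct_partitions_def inj_on_def)
  qed
  show "set ` distinct_partitions n = {A. finite A \<and> 0 \<notin> A \<and> \<Sum>A = n}"
  proof (intro set_eqI iffI)
    fix A assume "A \<in> set ` distinct_partitions n"
    then show "A \<in> {A. finite A \<and> 0 \<notin> A \<and> \<Sum>A = n}"
      by (auto simp: distinct_partitions_def partitions_def distinct_sum_list_conv_Sum)
  next
    fix A assume A: "A \<in> {A. finite A \<and> 0 \<notin> A \<and> \<Sum>A = n}"
    then have "mset_set A \<in> mset ` partitions n"
      unfolding mset_partitions by (simp add: sum_unfold_sum_mset)
    then obtain la where la: "la \<in> partitions n" "mset la = mset_set A" by auto
    then have "set la = A" using A by (metis (mono_tags, lifting) finite_set_mset_mset_set mem_Collect_eq set_mset_mset)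
    moreover have "distinct la" using la A 
      by (metis (no_types, lifting) mem_Collect_eq mset_eq_imp_distinct_iff mset_sorted_list_of_multiset sorted_list_of_mset_set distinct_sorted_list_of_set)
    ultimately show "A \<in> set ` distinct_partitions n"
      using la by (auto simp: distinct_partitions_def)
  qed
qed

text \<open>Split by membership of \<open>k\<close>. A set loses \<open>k\<close> for good when it
  is removed, so both terms on the right forbid \<open>insert k K\<close>: solving for one of them
  leaves the other, at a smaller target.\<close>

lemma distinct_count_insert:
  assumes "k > 0" "k \<notin> K"
  shows "distinct_count K m = distinct_count (insert k K) m + distinct_count (insert k K) (m - int k)"
proof -
  let ?X = "{A. finite A \<and> 0 \<notin> A \<and> A \<inter> K = {} \<and> int (\<Sum>A) = m}"
  let ?Y = "{A. finite A \<and> 0 \<notin> A \<and> A \<inter> insert k K = {} \<and> int (\<Sum>A) = m}"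
  let ?Z = "{A. finite A \<and> 0 \<notin> A \<and> A \<inter> insert k K = {} \<and> int (\<Sum>A) = m - int k}"
  have fin: "finite {A. finite A \<and> 0 \<notin> A \<and> A \<inter> J = {} \<and> int (\<Sum>A) = i}" for J i
    by (rule finite_subset[OF _ finite_distinct_sets[of i "\<lambda>_. True"]]) auto
  have "?X = ?Y \<union> insert k ` ?Z"
  proof (intro set_eqI iffI)
    fix A assume A: "A \<in> ?X"
    show "A \<in> ?Y \<union> insert k ` ?Z"
    proof (cases "k \<in> A")
      case True
      then have "A = insert k (A - {k})" "A - {k} \<in> ?Z"
        using A by (auto simp: sum.remove)
      then show ?thesis by blast
    qed (use A in auto)
  qed (use assms in auto)
  moreover have "card (?Y \<union> insert k ` ?Z) = card ?Y + card (insert k ` ?Z)"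
    by (rule card_Un_disjoint) (use fin[of "insert k K"] in auto)
  moreover have "card (insert k ` ?Z) = card ?Z"
    by (rule card_image) (auto simp: inj_on_def)
  ultimately show ?thesis unfolding distinct_count_def by simp
qed

text \<open>Split by occurrence of \<open>k\<close>, taking out one copy. More copies may remain, so
  the last term still forbids only \<open>K\<close>, and the count for \<open>insert k K\<close> is
  an explicit difference.\<close>

lemma odd_count_insert:
  assumes "odd k" "k \<notin> K"
  shows "odd_count K m = odd_count (insert k K) m + odd_count K (m - int k)"
proof -
  let ?X = "{M. (\<forall>x\<in>#M. odd x \<and> x \<notin> K) \<and> int (\<Sum>\<^sub># M) = m}"
  let ?Y = "{M. (\<forall>x\<in>#M. odd x \<and> x \<notin> insert k K) \<and> int (\<Sum>\<^sub># M) = m}"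
  let ?Z = "{M. (\<forall>x\<in>#M. odd x \<and> x \<notin> K) \<and> int (\<Sum>\<^sub># M) = m - int k}"
  have fin: "finite {M. (\<forall>x\<in>#M. odd x \<and> x \<notin> J) \<and> int (\<Sum>\<^sub># M) = i}" for J i
    by (rule finite_subset[OF _ finite_odd_multisets[of i "\<lambda>_. True"]]) auto
  have "?X = ?Y \<union> add_mset k ` ?Z"
  proof (intro set_eqI iffI)
    fix M assume M: "M \<in> ?X"
    show "M \<in> ?Y \<union> add_mset k ` ?Z"
    proof (cases "k \<in># M")
      case True
      then obtain M' where "M = add_mset k M'" by (meson multi_member_split)
      then show ?thesis using M by auto
    qed (use M in auto)
  qed (use assms in auto)
  moreover have "card (?Y \<union> add_mset k ` ?Z) = card ?Y + card (add_mset k ` ?Z)"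
    by (rule card_Un_disjoint) (use fin[of "insert k K" m] fin[of K "m - int k"] in \<open>blast, blast, fastforce\<close>)
  moreover have "card (add_mset k ` ?Z) = card ?Z"
    by (rule card_image) (auto simp: inj_on_def)
  ultimately show ?thesis unfolding odd_count_def by simp
qed

section \<open>Euler's theorem\<close>

definition set_fps :: "nat set \<Rightarrow> int fps" where
  "set_fps A = Abs_fps (\<lambda>n. int (card {X. X \<subseteq> A \<and> \<Sum>X = n}))"

definition multiset_fps :: "nat set \<Rightarrow> int fps" where
  "multiset_fps A = Abs_fps (\<lambda>n. int (card {M. set_mset M \<subseteq> A \<and> \<Sum>\<^sub># M = n}))"

lemma finite_multisets_sum:
  assumes "0 \<notin> A"
  shows "finite {M. set_mset M \<subseteq> A \<and> \<Sum>\<^sub># M = (n::nat)}"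
proof (rule finite_subset)
  show "{M. set_mset M \<subseteq> A \<and> \<Sum>\<^sub># M = n} \<subseteq> mset ` partitions n"
    unfolding mset_partitions using assms by auto
qed (simp add: finite_partitions)

lemma set_fps_insert:
  assumes "finite A" "k \<notin> A"
  shows "set_fps (insert k A) = (1 + fps_X ^ k) * set_fps A"
proof (rule fps_ext)
  fix n
  let ?Z = "{X. X \<subseteq> A \<and> k + \<Sum>X = n}"
  have fin: "finite {X. X \<subseteq> A \<and> P X}" for P
    by (rule finite_subset[of _ "Pow A"]) (use assms in auto)
  have "{X. X \<subseteq> insert k A \<and> \<Sum>X = n} = {X. X \<subseteq> A \<and> \<Sum>X = n} \<union> insert k ` ?Z"
  proof (intro set_eqI iffI)
    fix X assume X: "X \<in> {X. X \<subseteq> insert k A \<and> \<Sum>X = n}"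
    then have f: "finite X" using assms by (auto intro: finite_subset)
    show "X \<in> {X. X \<subseteq> A \<and> \<Sum>X = n} \<union> insert k ` ?Z"
    proof (cases "k \<in> X")
      case True
      then have "X = insert k (X - {k})" "X - {k} \<in> ?Z"
        using X f by (auto simp: sum.remove)
      then show ?thesis by blast
    qed (use X in auto)
  next
    fix X assume X: "X \<in> {X. X \<subseteq> A \<and> \<Sum>X = n} \<union> insert k ` ?Z"
    then show "X \<in> {X. X \<subseteq> insert k A \<and> \<Sum>X = n}"
    proof
      assume "X \<in> insert k ` ?Z"
      then obtain Y where Y: "Y \<subseteq> A" "k + \<Sum>Y = n" "X = insert k Y" by auto
      moreover have "finite Y" "k \<notin> Y" using Y assms by (auto intro: finite_subset)
      ultimately show ?thesis by auto
    qed auto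
  qed
  moreover have "card ({X. X \<subseteq> A \<and> \<Sum>X = n} \<union> insert k ` ?Z)
      = card {X. X \<subseteq> A \<and> \<Sum>X = n} + card (insert k ` ?Z)"
    by (rule card_Un_disjoint) (use fin assms in auto)
  moreover have "card (insert k ` ?Z) = card ?Z"
    by (rule card_image) (use assms in \<open>auto simp: inj_on_def\<close>)
  moreover have "int (card ?Z) = fps_nth (fps_X ^ k * set_fps A) n"
  proof (cases "n < k")
    case False
    then have "?Z = {X. X \<subseteq> A \<and> \<Sum>X = n - k}" by auto
    then show ?thesis using False by (simp add: fps_X_power_mult_nth set_fps_def)
  qed (auto simp: fps_X_power_mult_nth)
  ultimately show "fps_nth (set_fps (insert k A)) n = fps_nth ((1 + fps_X ^ k) * set_fps A) n"
    by (simp add: distrib_right set_fps_def)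
qed

text \<open>Taking out one copy of \<open>k\<close> gives a recursion; keeping
  \<open>1 - fps_X ^ k\<close> on the left avoids geometric series. Positive parts make the sets
  behind each coefficient finite.\<close>

lemma multiset_fps_insert:
  assumes "0 \<notin> A" "k \<notin> A" "k > 0"
  shows "(1 - fps_X ^ k) * multiset_fps (insert k A) = multiset_fps A"
proof (rule fps_ext)
  fix n
  let ?Z = "{M. set_mset M \<subseteq> insert k A \<and> k + \<Sum>\<^sub># M = n}"
  have "{M. set_mset M \<subseteq> insert k A \<and> \<Sum>\<^sub># M = n}
      = {M. set_mset M \<subseteq> A \<and> \<Sum>\<^sub># M = n} \<union> add_mset k ` ?Z"
  proof (intro set_eqI iffI)
    fix M assume M: "M \<in> {M. set_mset M \<subseteq> insert k A \<and> \<Sum>\<^sub># M = n}"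
    show "M \<in> {M. set_mset M \<subseteq> A \<and> \<Sum>\<^sub># M = n} \<union> add_mset k ` ?Z"
    proof (cases "k \<in># M")
      case True
      then obtain M' where "M = add_mset k M'" by (meson multi_member_split)
      then show ?thesis using M by auto
    qed (use M in auto)
  qed auto
  moreover have "?Z \<subseteq> {M. set_mset M \<subseteq> insert k A \<and> \<Sum>\<^sub># M = n - k}"
    by (rule Collect_mono) (metis diff_add_inverse)
  then have fin: "finite ?Z"
    by (rule finite_subset) (rule finite_multisets_sum, use assms in simp)
  have "card ({M. set_mset M \<subseteq> A \<and> \<Sum>\<^sub># M = n} \<union> add_mset k ` ?Z)
      = card {M. set_mset M \<subseteq> A \<and> \<Sum>\<^sub># M = n} + card (add_mset k ` ?Z)"
  proof (intro card_Un_disjoint finite_imageI)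
    show "{M. set_mset M \<subseteq> A \<and> \<Sum>\<^sub># M = n} \<inter> add_mset k ` ?Z = {}"
    proof (rule equals0I)
      fix M assume "M \<in> {M. set_mset M \<subseteq> A \<and> \<Sum>\<^sub># M = n} \<inter> add_mset k ` ?Z"
      then have "set_mset M \<subseteq> A" and "M \<in> add_mset k ` ?Z" by (simp_all only: Int_iff mem_Collect_eq)
      moreover from this obtain M' where "M = add_mset k M'" by (elim imageE)
      ultimately have "set_mset M \<subseteq> A" "k \<in># M" by (simp_all only: union_single_eq_member)
      then show False using assms(2) by blast
    qed
  qed (use fin finite_multisets_sum[OF assms(1)] in \<open>simp_all only:\<close>)
  moreover have "card (add_mset k ` ?Z) = card ?Z"
    by (rule card_image) (auto simp: inj_on_def)
  moreover have "int (card ?Z) = fps_nth (fps_X ^ k * multiset_fps (insert k A)) n"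
  proof (cases "n < k")
    case False
    then have "?Z = {M. set_mset M \<subseteq> insert k A \<and> \<Sum>\<^sub># M = n - k}" by auto
    then show ?thesis using False by (simp add: fps_X_power_mult_nth multiset_fps_def)
  qed (auto simp: fps_X_power_mult_nth)
  ultimately show "fps_nth ((1 - fps_X ^ k) * multiset_fps (insert k A)) n = fps_nth (multiset_fps A) n"
    by (simp add: left_diff_distrib multiset_fps_def)
qed

lemma set_fps_eq_prod: "finite A \<Longrightarrow> set_fps A = (\<Prod>k\<in>A. 1 + fps_X ^ k)"
proof (induction A rule: finite_induct)
  case empty
  have "{X. X = {} \<and> \<Sum>X = n} = (if n = 0 then {{}} else {})" for n :: nat
    by auto
  then have "set_fps {} = 1"
    by (intro fps_ext) (auto simp: set_fps_def)
  then show ?case by simp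
qed (simp add: set_fps_insert)

lemma multiset_fps_times_prod:
  "finite A \<Longrightarrow> 0 \<notin> A \<Longrightarrow> multiset_fps A * (\<Prod>k\<in>A. 1 - fps_X ^ k) = 1"
proof (induction A rule: finite_induct)
  case empty
  have "{M. set_mset M \<subseteq> {} \<and> \<Sum>\<^sub># M = n} = (if n = 0 then {{#}} else {})" for n :: nat
    by auto
  then have "multiset_fps {} = 1"
    by (intro fps_ext) (simp add: multiset_fps_def)
  then show ?case by simp
next
  case (insert k A)
  then have "(1 - fps_X ^ k) * multiset_fps (insert k A) = multiset_fps A"
    by (intro multiset_fps_insert) auto
  then have "multiset_fps (insert k A) * ((1 - fps_X ^ k) * (\<Prod>k\<in>A. 1 - fps_X ^ k))
      = multiset_fps A * (\<Prod>k\<in>A. 1 - fps_X ^ k)"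
    by (simp only: mult.assoc[symmetric] mult.commute[of "multiset_fps (insert k A)"])
  moreover have "multiset_fps A * (\<Prod>k\<in>A. 1 - fps_X ^ k) = 1" using insert by blast
  ultimately show ?case unfolding prod.insert[OF insert.hyps] by simp
qed

text \<open>Every factor is \<open>1\<close> modulo \<open>fps_X ^ Suc n\<close>.\<close>

lemma fps_nth_mult_prod_high:
  fixes F :: "int fps"
  assumes "finite J" "\<And>k. k \<in> J \<Longrightarrow> n < e k"
  shows "fps_nth (F * (\<Prod>k\<in>J. 1 - fps_X ^ e k)) n = fps_nth F n"
  using assms
proof (induction J rule: finite_induct)
  case (insert k J)
  let ?P = "F * (\<Prod>k\<in>J. 1 - fps_X ^ e k)"
  have "F * (\<Prod>k\<in>insert k J. 1 - fps_X ^ e k) = ?P - fps_X ^ e k * ?P"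
    using insert by (simp add: algebra_simps)
  moreover have "fps_nth (fps_X ^ e k * ?P) n = 0"
    using insert.prems[of k] by (simp add: fps_X_power_mult_nth)
  ultimately show ?case using insert by simp
qed simp

lemma prod_one_minus_X_power_nz:
  "finite A \<Longrightarrow> 0 \<notin> A \<Longrightarrow> (\<Prod>k\<in>A. 1 - fps_X ^ k) \<noteq> (0 :: int fps)"
  using multiset_fps_times_prod[of A] by (metis mult_zero_right zero_neq_one)

text \<open>No part exceeds the total, so finite products over \<open>{1..n}\<close> already
  determine the coefficient at \<open>n\<close> and infinite products are avoided.\<close>

lemma Collect_subset_interval_sum:
  "{A. A \<subseteq> {1..n} \<and> \<Sum>A = n} = {A. finite A \<and> 0 \<notin> A \<and> \<Sum>A = (n::nat)}"
proof (rule Collect_cong)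
  fix A :: "nat set"
  have "A \<subseteq> {1..\<Sum>A}" if "finite A" "0 \<notin> A"
  proof
    fix x assume x: "x \<in> A"
    have "x \<noteq> 0" using x that by metis
    moreover have "x \<le> \<Sum>A" by (rule member_le_sum[OF x]) (use that in simp_all)
    ultimately show "x \<in> {1..\<Sum>A}" by simp
  qed
  moreover have "finite A" "0 \<notin> A" if "A \<subseteq> {1..n}"
    using that finite_subset by auto
  ultimately show "A \<subseteq> {1..n} \<and> \<Sum>A = n \<longleftrightarrow> finite A \<and> 0 \<notin> A \<and> \<Sum>A = n" by metis
qed

lemma Collect_subset_odd_interval_sum:
  "{M. set_mset M \<subseteq> {k\<in>{1..n}. odd k} \<and> \<Sum>\<^sub># M = n} = {M. (\<forall>x\<in>#M. odd x) \<and> \<Sum>\<^sub># M = (n::nat)}"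
proof (rule Collect_cong)
  fix M :: "nat multiset"
  have "x \<in> {1..\<Sum>\<^sub># M}" if "x \<in># M" "odd x" for x
    using that sum_mset.remove[OF that(1)] by (auto simp: Suc_le_eq odd_pos)
  then show "set_mset M \<subseteq> {k\<in>{1..n}. odd k} \<and> \<Sum>\<^sub># M = n \<longleftrightarrow> (\<forall>x\<in>#M. odd x) \<and> \<Sum>\<^sub># M = n"
    by blast
qed

text \<open>Euler: multiply both generating functions by \<open>\<Prod>k\<le>n. 1 - X^k\<close>; the factors
  \<open>1 - X^(2k)\<close> with \<open>n < 2k\<close> do not affect the coefficient of \<open>X^n\<close>.\<close>

lemma one_plus_times_one_minus: "(1 + y) * (1 - y) = 1 - y * (y :: 'a :: comm_ring_1)"
  by (simp add: algebra_simps)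

lemma card_odd_multisets_eq_card_distinct_sets:
  fixes n :: nat
  shows "card {M. (\<forall>x\<in>#M. odd x) \<and> \<Sum>\<^sub># M = n} = card {A. finite A \<and> 0 \<notin> A \<and> \<Sum>A = n}"
proof -
  let ?O = "{k\<in>{1..n}. odd k}" and ?L = "{k\<in>{1..n}. 2 * k \<le> n}" and ?H = "{k\<in>{1..n}. n < 2 * k}"
  let ?pr = "\<lambda>A. (\<Prod>k\<in>A. 1 - fps_X ^ k) :: int fps"
  let ?pr2 = "\<lambda>A. (\<Prod>k\<in>A. 1 - fps_X ^ (2 * k)) :: int fps"
  have "set_fps {1..n} * ?pr {1..n} = (\<Prod>k\<in>{1..n}. (1 + fps_X ^ k) * (1 - fps_X ^ k))"
    by (subst set_fps_eq_prod) (simp_all only: prod.distrib finite_atLeastAtMost)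
  also have "\<dots> = ?pr2 {1..n}"
    by (intro prod.cong refl) (simp only: mult_2 power_add one_plus_times_one_minus)
  also have "\<dots> = ?pr2 (?L \<union> ?H)" by (rule prod.cong) auto
  also have "\<dots> = ?pr2 ?L * ?pr2 ?H" by (rule prod.union_disjoint) auto
  also have "?pr2 ?L = ?pr ((*) 2 ` ?L)"
    by (subst prod.reindex) (simp_all only: o_def inj_on_def, simp)
  finally have 1: "set_fps {1..n} * ?pr {1..n} = ?pr ((*) 2 ` ?L) * ?pr2 ?H" .
  \<comment> \<open>The doubles of \<open>?L\<close> are exactly the even numbers up to
    \<open>n\<close>, so the product over them is a common factor of both sides and cancels, leaving
    the odd factors.\<close>
  have "{1..n} = ?O \<union> (*) 2 ` ?L"
  proof (intro set_eqI iffI)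
    fix x assume x: "x \<in> {1..n}"
    show "x \<in> ?O \<union> (*) 2 ` ?L"
    proof (cases "odd x")
      case False
      then obtain y where y: "x = 2 * y" using evenE by blast
      then have "y \<in> ?L" using x by auto
      then show ?thesis using y by blast
    qed (use x in blast)
  qed auto
  then have "?pr {1..n} = ?pr (?O \<union> (*) 2 ` ?L)" by (rule arg_cong)
  also have "\<dots> = ?pr ?O * ?pr ((*) 2 ` ?L)"
  proof (rule prod.union_disjoint)
    show "?O \<inter> (*) 2 ` ?L = {}" by fastforce
  qed simp_all
  finally have 2: "?pr {1..n} = ?pr ?O * ?pr ((*) 2 ` ?L)" .
  have nz: "?pr ((*) 2 ` ?L) \<noteq> 0"
    by (rule prod_one_minus_X_power_nz) (simp, force)
  have "?pr ((*) 2 ` ?L) * (set_fps {1..n} * ?pr ?O) = ?pr ((*) 2 ` ?L) * ?pr2 ?H"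
    using 1 unfolding 2 by (simp only: ac_simps)
  then have "set_fps {1..n} * ?pr ?O = ?pr2 ?H"
    using nz mult_left_cancel by blast
  moreover have "multiset_fps ?O * ?pr ?O = 1"
    by (rule multiset_fps_times_prod) auto
  moreover have "s = m * r" if "s * p = r" "m * p = 1" for s m p r :: "int fps"
  proof -
    have "m * r = s * (m * p)" unfolding that(1)[symmetric] by (simp only: ac_simps)
    then show ?thesis using that by simp
  qed
  ultimately have "set_fps {1..n} = multiset_fps ?O * ?pr2 ?H" by blast
  then have "fps_nth (set_fps {1..n}) n = fps_nth (multiset_fps ?O * ?pr2 ?H) n" by simp
  also have "\<dots> = fps_nth (multiset_fps ?O) n"
    by (rule fps_nth_mult_prod_high) simp_all
  finally have "fps_nth (set_fps {1..n}) n = fps_nth (multiset_fps ?O) n" .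
  then have "card {X. X \<subseteq> {1..n} \<and> \<Sum>X = n} = card {M. set_mset M \<subseteq> ?O \<and> \<Sum>\<^sub># M = n}"
    unfolding set_fps_def multiset_fps_def by (simp only: fps_nth_Abs_fps of_nat_eq_iff)
  then show ?thesis
    unfolding Collect_subset_interval_sum Collect_subset_odd_interval_sum ..
qed

section \<open>Hook numbers\<close>

lemma count_hook_numbers_card:
  "count (hook_numbers la) h = card {x \<in> ferrers_diagram la. card (hook la x) = h}"
proof -
  have "count (hook_numbers la) h = (\<Sum>x | x \<in> ferrers_diagram la \<and> card (hook la x) = h. 1)"
    unfolding hook_numbers_def count_image_mset
    using finite_ferrers_diagram by (intro sum.cong) auto
  then show ?thesis by simp
qed

lemma ferrers_diagram_Cons:
  "ferrers_diagram (x # xs) = Pair 0 ` {..<x} \<union> map_prod Suc id ` ferrers_diagram xs"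
proof (intro set_eqI iffI)
  fix z assume "z \<in> ferrers_diagram (x # xs)"
  then show "z \<in> Pair 0 ` {..<x} \<union> map_prod Suc id ` ferrers_diagram xs"
    by (cases z; cases "fst z") (force simp: ferrers_diagram_def image_iff)+
qed (auto simp: ferrers_diagram_def)

lemma card_hook_Cons_Suc: "card (hook (x # xs) (Suc i, j)) = card (hook xs (i, j))"
proof -
  have "hook (x # xs) (Suc i, j) = map_prod Suc id ` hook xs (i, j)"
    unfolding hook_def ferrers_diagram_Cons by force
  moreover have "inj_on (map_prod Suc id) (hook xs (i, j))"
    by (auto simp: inj_on_def)
  ultimately show ?thesis by (simp only: card_image)
qed

lemma card_hook_Cons_0:
  assumes "j < x"
  shows "card (hook (x # xs) (0, j)) = x - j + length (filter (\<lambda>y. j < y) xs)"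
proof -
  have "hook (x # xs) (0, j) = Pair 0 ` {j..<x} \<union> (\<lambda>i. (Suc i, j)) ` {i. i < length xs \<and> j < xs ! i}"
    using assms unfolding hook_def ferrers_diagram_Cons by (force simp: ferrers_diagram_def)
  moreover have "card (Pair 0 ` {j..<x} \<union> (\<lambda>i. (Suc i, j)) ` {i. i < length xs \<and> j < xs ! i})
      = card (Pair 0 ` {j..<x} :: (nat \<times> nat) set) + card ((\<lambda>i. (Suc i, j)) ` {i. i < length xs \<and> j < xs ! i})"
    by (rule card_Un_disjoint) auto
  ultimately show ?thesis
    by (simp add: card_image inj_on_def length_filter_conv_card)
qed

text \<open>A triple \<open>(p, a, r)\<close> stands for the box with arm \<open>a\<close> in a row of length \<open>p\<close> which is followed
  by exactly \<open>r\<close> rows of the same length.\<close>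

definition hook_triples :: "nat \<Rightarrow> nat multiset \<Rightarrow> (nat \<times> nat \<times> nat) set" where
  "hook_triples h M = {(p, a, r). a < p \<and> r < count M p \<and>
     r + size (filter_mset (\<lambda>y. p \<le> y + a \<and> y < p) M) + a + 1 = h}"

lemma finite_hook_triples: "finite (hook_triples h M)"
proof (rule finite_subset)
  show "hook_triples h M \<subseteq> set_mset M \<times> {..h} \<times> {..h}"
    by (auto simp: hook_triples_def) (metis count_greater_zero_iff gr_zeroI not_less_zero)
qed simp

text \<open>A new top row of maximal length \<open>x\<close> changes no leg of an old row, because
  the leg condition \<open>y < p\<close> with \<open>p \<le> x\<close> never sees \<open>x\<close>.
  The new row is followed by \<open>count M x\<close> equal rows, which fixes the third component of
  its triples.\<close>

lemma hook_triples_add_max: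
  assumes "\<forall>y\<in>#M. y \<le> x"
  shows "hook_triples h (add_mset x M) = hook_triples h M \<union>
    (\<lambda>a. (x, a, count M x)) ` {a. a < x \<and> size (filter_mset (\<lambda>y. x \<le> y + a) M) + a + 1 = h}"
proof -
  have f: "filter_mset (\<lambda>y. p \<le> y + a \<and> y < p) (add_mset x M) = filter_mset (\<lambda>y. p \<le> y + a \<and> y < p) M"
    if "r < count (add_mset x M) p" for p a r
  proof -
    have "p \<in># add_mset x M" using that by (metis count_greater_zero_iff gr_zeroI not_less_zero)
    then have "p \<le> x" using assms by auto
    then show ?thesis by simp
  qed
  have g: "size (filter_mset (\<lambda>y. x \<le> y + a) M) = count M x + size (filter_mset (\<lambda>y. x \<le> y + a \<and> y < x) M)" for a
  proof -
    have "filter_mset (\<lambda>y. x \<le> y + a) M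
        = filter_mset (\<lambda>y. y = x) M + filter_mset (\<lambda>y. x \<le> y + a \<and> y < x) M"
      using assms by (intro multiset_eqI) (auto simp: not_in_iff[symmetric] le_less not_le intro!: count_eq_zero_iff[THEN iffD2])
    then show ?thesis by (simp add: filter_eq_replicate_mset)
  qed
  show ?thesis
  proof (intro set_eqI iffI)
    fix z assume z: "z \<in> hook_triples h (add_mset x M)"
    obtain p a r where [simp]: "z = (p, a, r)" by (metis prod_cases3)
    show "z \<in> hook_triples h M \<union> (\<lambda>a. (x, a, count M x)) ` {a. a < x \<and> size (filter_mset (\<lambda>y. x \<le> y + a) M) + a + 1 = h}"
    proof (cases "r < count M p")
      case True
      then show ?thesis using z f[of r p a] by (auto simp: hook_triples_def)
    next
      case False
      then have "p = x" "r = count M x" using z by (auto simp: hook_triples_def split: if_splits)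
      then show ?thesis using z f[of r p a] g[of a] by (auto simp: hook_triples_def)
    qed
  next
    fix z assume z: "z \<in> hook_triples h M \<union> (\<lambda>a. (x, a, count M x)) ` {a. a < x \<and> size (filter_mset (\<lambda>y. x \<le> y + a) M) + a + 1 = h}"
    obtain p a r where [simp]: "z = (p, a, r)" by (metis prod_cases3)
    have "r < count (add_mset x M) p" using z by (auto simp: hook_triples_def)
    from f[OF this, of a] show "z \<in> hook_triples h (add_mset x M)"
      using z g[of a] by (auto simp: hook_triples_def)
  qed
qed

text \<open>Induction on the rows from the top. In the first row, column \<open>j\<close> and arm
  \<open>a\<close> are exchanged by \<open>j \<mapsto> x - 1 - j\<close>, which is its own inverse;
  the test \<open>j < y\<close> for a lower row to reach the column becomes
  \<open>x \<le> y + a\<close>.\<close>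

lemma count_hook_numbers:
  "sorted_wrt (\<ge>) la \<Longrightarrow> count (hook_numbers la) h = card (hook_triples h (mset la))"
proof (induction la)
  case Nil
  then show ?case by (simp add: hook_numbers_def ferrers_diagram_def hook_triples_def card_eq_0_iff)
next
  case (Cons x xs)
  let ?B = "{x \<in> ferrers_diagram xs. card (hook xs x) = h}"
  let ?J = "{j. j < x \<and> x - j + length (filter (\<lambda>y. j < y) xs) = h}"
  let ?A = "{a. a < x \<and> size (filter_mset (\<lambda>y. x \<le> y + a) (mset xs)) + a + 1 = h}"
  have fin: "finite ?B" by (rule finite_subset[OF _ finite_ferrers_diagram]) auto
  have "{z \<in> ferrers_diagram (x # xs). card (hook (x # xs) z) = h} = Pair 0 ` ?J \<union> map_prod Suc id ` ?B"
    unfolding ferrers_diagram_Cons by (auto simp: card_hook_Cons_0 card_hook_Cons_Suc)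
  then have "count (hook_numbers (x # xs)) h = card (Pair 0 ` ?J \<union> map_prod Suc id ` ?B :: (nat \<times> nat) set)"
    unfolding count_hook_numbers_card by (rule arg_cong)
  also have "\<dots> = card (Pair 0 ` ?J :: (nat \<times> nat) set) + card (map_prod Suc id ` ?B)"
    by (rule card_Un_disjoint) (use fin in auto)
  also have "\<dots> = card ?J + card ?B"
    by (simp add: card_image inj_on_def)
  also have "card ?J = card ?A"
  proof (rule bij_betw_same_card[of "\<lambda>j. x - 1 - j"])
    have e: "length (filter (\<lambda>y. j < y) xs) = size (filter_mset (\<lambda>y. x \<le> y + (x - 1 - j)) (mset xs))" if "j < x" for j
    proof -
      have "(j < y) = (x \<le> y + (x - 1 - j))" for y using that by linarith
      then show ?thesis by (simp flip: mset_filter)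
    qed
    show "bij_betw (\<lambda>j. x - 1 - j) ?J ?A"
    proof (rule bij_betw_byWitness[where f' = "\<lambda>j. x - 1 - j"])
      show "(\<lambda>j. x - 1 - j) ` ?J \<subseteq> ?A" using e by auto
      show "(\<lambda>j. x - 1 - j) ` ?A \<subseteq> ?J"
      proof
        fix j assume "j \<in> (\<lambda>j. x - 1 - j) ` ?A"
        then obtain a where a: "a \<in> ?A" "j = x - 1 - a" by auto
        then have "j < x" "x - 1 - j = a" by auto
        then show "j \<in> ?J" using e[of j] a by auto
      qed
    qed auto
  qed
  also have "card ?B = card (hook_triples h (mset xs))"
    using Cons by (simp add: count_hook_numbers_card)
  also have "card ?A = card ((\<lambda>a. (x, a, count (mset xs) x)) ` ?A)"
    by (simp add: card_image inj_on_def)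
  also have "\<dots> + card (hook_triples h (mset xs)) = card ((\<lambda>a. (x, a, count (mset xs) x)) ` ?A \<union> hook_triples h (mset xs))"
    by (rule card_Un_disjoint[symmetric]) (auto simp: finite_hook_triples, auto simp: hook_triples_def)
  also have "\<dots> = card (hook_triples h (mset (x # xs)))"
    using Cons.prems by (simp add: hook_triples_add_max Un_commute)
  finally show ?case .
qed

text \<open>Subtracting \<open>R\<close> is a bijection. On \<open>K\<close> the multiplicities are
  exact, so nothing of \<open>K\<close> remains; a part of \<open>R\<close> outside \<open>K\<close>
  is only bounded from below and may remain.\<close>

lemma card_odd_multisets_prescribed:
  assumes "\<forall>x\<in>#R. odd x"
  shows "card {M. (\<forall>x\<in>#M. odd x) \<and> int (\<Sum>\<^sub># M) = m \<and> R \<subseteq># M \<and> (\<forall>k\<in>K. count M k = count R k)}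
    = odd_count K (m - int (\<Sum>\<^sub># R))"
proof -
  let ?Z = "{M. (\<forall>x\<in>#M. odd x \<and> x \<notin> K) \<and> int (\<Sum>\<^sub># M) = m - int (\<Sum>\<^sub># R)}"
  have "{M. (\<forall>x\<in>#M. odd x) \<and> int (\<Sum>\<^sub># M) = m \<and> R \<subseteq># M \<and> (\<forall>k\<in>K. count M k = count R k)}
      = (+) R ` ?Z" (is "?X = _")
  proof (intro set_eqI iffI)
    fix M assume M: "M \<in> ?X"
    then obtain N where N: "M = R + N" by (auto simp: mset_subset_eq_exists_conv)
    then have "N \<in> ?Z" using M by (auto simp: count_eq_zero_iff simp del: of_nat_sum_mset)
    then show "M \<in> (+) R ` ?Z" using N by blast
  next
    fix M assume "M \<in> (+) R ` ?Z"
    then obtain N where N: "M = R + N" "N \<in> ?Z" by blast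
    then have "count N k = 0" if "k \<in> K" for k using that by (auto simp: count_eq_zero_iff)
    moreover have "\<forall>x\<in>#N. odd x" "int (\<Sum>\<^sub># N) = m - int (\<Sum>\<^sub># R)" using N by blast+
    ultimately show "M \<in> ?X" using N(1) assms by (auto simp del: of_nat_sum_mset)
  qed
  then show ?thesis unfolding odd_count_def by (simp add: card_image)
qed

lemma card_distinct_sets_prescribed:
  assumes "R \<subseteq> K" "finite R" "0 \<notin> R"
  shows "card {A. finite A \<and> 0 \<notin> A \<and> int (\<Sum>A) = m \<and> A \<inter> K = R} = distinct_count K (m - int (\<Sum>R))"
proof -
  let ?Z = "{A. finite A \<and> 0 \<notin> A \<and> A \<inter> K = {} \<and> int (\<Sum>A) = m - int (\<Sum>R)}"
  have "{A. finite A \<and> 0 \<notin> A \<and> int (\<Sum>A) = m \<and> A \<inter> K = R} = (\<union>) R ` ?Z" (is "?X = _")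
  proof (intro set_eqI iffI)
    fix A assume A: "A \<in> ?X"
    then have "\<Sum>(A - R) + \<Sum>R = \<Sum>A" by (intro sum.subset_diff[symmetric]) auto
    then have "A - R \<in> ?Z" using A assms by (auto simp del: of_nat_sum)
    moreover have "A = R \<union> (A - R)" using A by auto
    ultimately show "A \<in> (\<union>) R ` ?Z" by blast
  next
    fix A assume "A \<in> (\<union>) R ` ?Z"
    then obtain N where N: "A = R \<union> N" "N \<in> ?Z" by blast
    then have "\<Sum>A = \<Sum>R + \<Sum>N" using assms by (subst N(1), intro sum.union_disjoint) auto
    then show "A \<in> ?X" using N assms by (auto simp del: of_nat_sum)
  qed
  moreover have "inj_on ((\<union>) R) ?Z" using assms(1) by (auto simp: inj_on_def)
  ultimately show ?thesis unfolding distinct_count_def by (simp add: card_image)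
qed

section \<open>Counting hooks by avoided parts\<close>

text \<open>With \<open>p = 2 * u + 1\<close>, the condition \<open>a < p\<close> reads
  \<open>u \<ge> (a + 1) div 2\<close>. All parts are at most \<open>n\<close>; the range goes on to
  \<open>2 * n\<close> to leave room for the bounded shifts in the later limits.\<close>

lemma card_hook_triples_odd:
  assumes "\<forall>x\<in>#M. odd x" "\<Sum>\<^sub># M = n"
  shows "card (hook_triples h M) = (\<Sum>a<h. \<Sum>u=(a + 1) div 2..2*n.
    card {r. r < count M (2*u+1) \<and> r + size (filter_mset (\<lambda>y. 2*u+1 \<le> y + a \<and> y < 2*u+1) M) + a + 1 = h})"
proof -
  let ?R = "\<lambda>a u. {r. r < count M (2*u+1) \<and> r + size (filter_mset (\<lambda>y. 2*u+1 \<le> y + a \<and> y < 2*u+1) M) + a + 1 = h}"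
  let ?S = "SIGMA a:{..<h}. SIGMA u:{(a + 1) div 2..2*n}. ?R a u"
  have "hook_triples h M = (\<lambda>(a, u, r). (2*u+1, a, r)) ` ?S"
  proof (intro set_eqI iffI)
    fix z assume z: "z \<in> hook_triples h M"
    obtain p a r where zz: "z = (p, a, r)" by (metis prod_cases3)
    have "r < count M p" using z by (auto simp: zz hook_triples_def)
    then have pM: "p \<in># M" by (metis count_greater_zero_iff gr_zeroI not_less_zero)
    then have "odd p" "p \<le> n" using assms sum_mset.remove[OF pM] by auto
    then obtain u where u: "p = 2 * u + 1" by (metis oddE)
    then have "(a, u, r) \<in> ?S" using z \<open>p \<le> n\<close> by (auto simp: zz hook_triples_def)
    then show "z \<in> (\<lambda>(a, u, r). (2*u+1, a, r)) ` ?S"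
      unfolding zz u by (rule rev_image_eqI) simp
  qed (auto simp: hook_triples_def)
  moreover have "inj_on (\<lambda>(a, u, r). (2*u+1, a, r)) ?S" by (auto simp: inj_on_def)
  ultimately have "card (hook_triples h M) = card ?S" by (simp only: card_image)
  also have "\<dots> = (\<Sum>a<h. \<Sum>u=(a + 1) div 2..2*n. card (?R a u))"
    by (simp add: card_SigmaI)
  finally show ?thesis .
qed

lemma card_hook_triples_distinct:
  assumes "finite A" "0 \<notin> A" "\<Sum>A = n"
  shows "card (hook_triples h (mset_set A)) = (\<Sum>a<h. card {p\<in>{a+1..2*n}. p \<in> A \<and> card (A \<inter> {p - a..<p}) + a + 1 = h})"
proof -
  let ?R = "\<lambda>a. {p\<in>{a+1..2*n}. p \<in> A \<and> card (A \<inter> {p - a..<p}) + a + 1 = h}"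
  let ?S = "SIGMA a:{..<h}. ?R a"
  have f: "filter_mset (\<lambda>y. p \<le> y + a \<and> y < p) (mset_set A) = mset_set (A \<inter> {p - a..<p})" for p a
  proof -
    have "{x \<in> A. p \<le> x + a \<and> x < p} = A \<inter> {p - a..<p}" by auto
    then show ?thesis using assms(1) by (simp add: filter_mset_mset_set)
  qed
  have "hook_triples h (mset_set A) = (\<lambda>(a, p). (p, a, 0)) ` ?S"
  proof (intro set_eqI iffI)
    fix z assume z: "z \<in> hook_triples h (mset_set A)"
    obtain p a r where zz: "z = (p, a, r)" by (metis prod_cases3)
    have *: "r < count (mset_set A) p" using z by (auto simp: zz hook_triples_def)
    then have pA: "p \<in> A" and r: "r = 0" using assms(1) by (auto simp: count_mset_set' split: if_splits)
    have "p \<le> n" using member_le_sum[OF pA, of "\<lambda>x. x"] assms by simp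
    then have "(a, p) \<in> ?S" using z pA r by (auto simp: zz hook_triples_def f)
    then show "z \<in> (\<lambda>(a, p). (p, a, 0)) ` ?S" by (force simp: zz r)
  qed (use assms in \<open>auto simp: hook_triples_def f\<close>)
  moreover have "inj_on (\<lambda>(a, p). (p, a, 0::nat)) ?S" by (auto simp: inj_on_def)
  ultimately have "card (hook_triples h (mset_set A)) = card ?S" by (simp only: card_image)
  also have "\<dots> = (\<Sum>a<h. card (?R a))"
    by (rule card_SigmaI) auto
  finally show ?thesis .
qed

lemma sum_card_swap:
  assumes "finite X" "finite Y"
  shows "(\<Sum>x\<in>X. card {y\<in>Y. P x y}) = (\<Sum>y\<in>Y. card {x\<in>X. P x y})"
proof -
  have "(\<Sum>x\<in>X. card {y\<in>Y. P x y}) = (\<Sum>x\<in>X. \<Sum>y\<in>Y. if P x y then 1 else 0)"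
    using assms by (intro sum.cong refl) (simp add: sum.inter_filter[symmetric])
  also have "\<dots> = (\<Sum>y\<in>Y. \<Sum>x\<in>X. if P x y then 1 else 0)" by (rule sum.swap)
  also have "\<dots> = (\<Sum>y\<in>Y. card {x\<in>X. P x y})"
    using assms by (intro sum.cong refl) (simp add: sum.inter_filter[symmetric])
  finally show ?thesis .
qed

definition top_block :: "nat \<Rightarrow> nat \<Rightarrow> nat set" where
  "top_block p k = {x. p < x + k \<and> x \<le> p}"

text \<open>The odd numbers directly below \<open>p\<close>, without \<open>p\<close> itself: rows
  of length \<open>p\<close> above the box are unrestricted. For distinct parts \<open>p\<close>
  occurs once, hence \<open>top_block\<close> contains it.\<close>

definition odd_block :: "nat \<Rightarrow> nat \<Rightarrow> nat set" where
  "odd_block p f = (\<lambda>i. p - 2 * i) ` {1..f}"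

text \<open>\<open>T\<close> records the distances from \<open>p\<close> of the
  \<open>h - 1 - a\<close> parts in \<open>{p - a..<p}\<close>. Together with \<open>p\<close> they
  weigh \<open>(h - a) * p - \<Sum>T\<close>, and the other parts avoid the block.\<close>

lemma distinct_hooks_eq:
  "distinct_hooks h n = (\<Sum>a<h. \<Sum>T | T \<subseteq> {1..a} \<and> card T = h - 1 - a. \<Sum>p=a+1..2*n.
     distinct_count (top_block p (a + 1)) (int n - int (h - a) * int p + int (\<Sum>T)))"
proof -
  let ?D = "{A. finite A \<and> 0 \<notin> A \<and> \<Sum>A = n}"
  let ?T = "\<lambda>a. {T. T \<subseteq> {1..a} \<and> card T = h - 1 - a}"
  have fin: "finite ?D"
    by (rule finite_subset[OF _ finite_distinct_sets[of "int n" "\<lambda>_. True"]]) auto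
  have finT: "finite (?T a)" for a by (rule finite_subset[of _ "Pow {1..a}"]) auto
  have "distinct_hooks h n = (\<Sum>la\<in>distinct_partitions n. card (hook_triples h (mset_set (set la))))"
    unfolding distinct_hooks_def
    by (intro sum.cong refl) (auto simp: distinct_partitions_def partitions_def count_hook_numbers mset_set_set)
  also have "\<dots> = (\<Sum>A\<in>?D. card (hook_triples h (mset_set A)))"
    by (rule sum.reindex_bij_betw[OF bij_betw_distinct_partitions])
  also have "\<dots> = (\<Sum>A\<in>?D. \<Sum>a<h. card {p\<in>{a+1..2*n}. p \<in> A \<and> card (A \<inter> {p - a..<p}) + a + 1 = h})"
    by (intro sum.cong refl card_hook_triples_distinct) auto
  also have "\<dots> = (\<Sum>a<h. \<Sum>p=a+1..2*n. card {A\<in>?D. p \<in> A \<and> card (A \<inter> {p - a..<p}) + a + 1 = h})"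
    by (subst sum.swap) (intro sum.cong refl sum_card_swap fin finite_atLeastAtMost)
  also have "\<dots> = (\<Sum>a<h. \<Sum>p=a+1..2*n. \<Sum>T\<in>?T a.
     distinct_count (top_block p (a + 1)) (int n - int (h - a) * int p + int (\<Sum>T)))"
  proof (intro sum.cong refl)
    fix a p assume a: "a \<in> {..<h}" and p: "p \<in> {a + 1..2 * n}"
    let ?cond = "\<lambda>T A. A \<inter> top_block p (a + 1) = insert p ((-) p ` T)"
    have block: "top_block p (a + 1) = insert p {p - a..<p}" using p by (auto simp: top_block_def)
    have T: "(-) p ` T \<subseteq> {p - a..<p}" "inj_on ((-) p) T" "finite T" "card ((-) p ` T) = card T" if "T \<subseteq> {1..a}" for T
    proof -
      show "(-) p ` T \<subseteq> {p - a..<p}" using that p by fastforce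
      show i: "inj_on ((-) p) T" using that p by (fastforce simp: inj_on_def)
      show "finite T" using that by (auto intro: finite_subset)
      show "card ((-) p ` T) = card T" by (rule card_image[OF i])
    qed
    \<comment> \<open>A given \<open>A\<close> matches exactly one candidate \<open>T\<close>, its
      own pattern of distances, provided that this pattern has the right size; this turns a
      cardinality condition into a sum over patterns.\<close>
    have one: "card {T \<in> ?T a. ?cond T A} = (if p \<in> A \<and> card (A \<inter> {p - a..<p}) + a + 1 = h then 1 else 0)"
      (is "card ?C = _") if A: "A \<in> ?D" for A
    proof -
      define U where "U = (-) p ` (A \<inter> {p - a..<p})"
      have sub: "A \<inter> {p - a..<p} \<subseteq> {..p}" by auto
      have U: "U \<subseteq> {1..a}" "(-) p ` U = A \<inter> {p - a..<p}"
      proof -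
        show "U \<subseteq> {1..a}" using p unfolding U_def by fastforce
        show "(-) p ` U = A \<inter> {p - a..<p}" unfolding U_def image_image
          by (rule trans[OF image_cong[OF refl, of _ _ "\<lambda>x. x"]]) auto
      qed
      have "card (A \<inter> {p - a..<p}) = card U" using T(4)[OF U(1)] U(2) by simp
      moreover have "?cond T A \<longleftrightarrow> p \<in> A \<and> T = U" if "T \<subseteq> {1..a}" for T
      proof -
        have "?cond T A \<longleftrightarrow> p \<in> A \<and> (-) p ` T = A \<inter> {p - a..<p}"
          unfolding block using T(1)[OF that] by auto
        also have "(-) p ` T = A \<inter> {p - a..<p} \<longleftrightarrow> T = U"
        proof
          assume e: "(-) p ` T = A \<inter> {p - a..<p}"
          have "T = (-) p ` (-) p ` T" unfolding image_image
            by (rule sym, rule trans[OF image_cong[OF refl, of _ _ "\<lambda>x. x"]]) (use that p in auto)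
          then show "T = U" unfolding e U_def .
        qed (use U in simp)
        finally show ?thesis .
      qed
      ultimately have "?C = (if p \<in> A \<and> card (A \<inter> {p - a..<p}) + a + 1 = h then {U} else {})"
        using U a by auto
      then show ?thesis by simp
    qed
    have "card {A\<in>?D. p \<in> A \<and> card (A \<inter> {p - a..<p}) + a + 1 = h}
        = (\<Sum>A\<in>?D. if p \<in> A \<and> card (A \<inter> {p - a..<p}) + a + 1 = h then 1 else 0)"
      unfolding sum.inter_filter[OF fin, symmetric] by simp
    also have "\<dots> = (\<Sum>A\<in>?D. card {T \<in> ?T a. ?cond T A})"
      by (intro sum.cong refl one[symmetric])
    also have "\<dots> = (\<Sum>T\<in>?T a. card {A \<in> ?D. ?cond T A})"
      by (rule sum_card_swap[OF fin finT])
    also have "\<dots> = (\<Sum>T\<in>?T a. distinct_count (top_block p (a + 1)) (int n - int (h - a) * int p + int (\<Sum>T)))"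
    proof (rule sum.cong[OF refl])
      fix T assume TT: "T \<in> ?T a"
      then have sub: "T \<subseteq> {1..a}" by simp
      have pn: "p \<notin> (-) p ` T" using T(1)[OF sub] by auto
      have "\<Sum>((-) p ` T) = (\<Sum>s\<in>T. p - s)" using T(2)[OF sub] by (simp add: sum.reindex)
      then have "int (\<Sum>((-) p ` T)) = (\<Sum>s\<in>T. int p - int s)"
        using sub p by (auto simp: of_nat_diff intro!: sum.cong)
      then have "int (\<Sum>((-) p ` T)) = int (h - 1 - a) * int p - int (\<Sum>T)"
        using TT by (simp add: sum_subtractf)
      then have s: "int (\<Sum>(insert p ((-) p ` T))) = int (h - a) * int p - int (\<Sum>T)"
        using pn T(3)[OF sub] a by (simp add: algebra_simps of_nat_diff del: of_nat_sum)
      have "{A \<in> ?D. ?cond T A} = {A. finite A \<and> 0 \<notin> A \<and> int (\<Sum>A) = int n \<and> ?cond T A}"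
        by (auto simp del: of_nat_sum)
      then have "card {A \<in> ?D. ?cond T A}
         = card {A. finite A \<and> 0 \<notin> A \<and> int (\<Sum>A) = int n \<and> ?cond T A}" by (rule arg_cong)
      also have "\<dots> = distinct_count (top_block p (a + 1)) (int n - int (\<Sum>(insert p ((-) p ` T))))"
      proof (rule card_distinct_sets_prescribed)
        show "insert p ((-) p ` T) \<subseteq> top_block p (a + 1)" unfolding block using T(1)[OF sub] by auto
        show "finite (insert p ((-) p ` T))" using T(3)[OF sub] by simp
        show "0 \<notin> insert p ((-) p ` T)" using T(1)[OF sub] p by auto
      qed
      finally show "card {A \<in> ?D. ?cond T A}
          = distinct_count (top_block p (a + 1)) (int n - int (h - a) * int p + int (\<Sum>T))"
        unfolding s by (simp add: algebra_simps)
    qed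
    finally show "card {A\<in>?D. p \<in> A \<and> card (A \<inter> {p - a..<p}) + a + 1 = h}
      = (\<Sum>T\<in>?T a. distinct_count (top_block p (a + 1)) (int n - int (h - a) * int p + int (\<Sum>T)))" .
  qed
  also have "\<dots> = (\<Sum>a<h. \<Sum>T\<in>?T a. \<Sum>p=a+1..2*n.
     distinct_count (top_block p (a + 1)) (int n - int (h - a) * int p + int (\<Sum>T)))"
    by (intro sum.cong refl sum.swap)
  finally show ?thesis .
qed

lemma size_filter_odd_multiset:
  fixes p a :: nat
  assumes "\<forall>x\<in>#M. odd x" "odd p" "a < p"
  shows "size (filter_mset (\<lambda>y. p \<le> y + a \<and> y < p) M) = (\<Sum>i=1..a div 2. count M (p - 2 * i))"
proof -
  let ?N = "filter_mset (\<lambda>y. p \<le> y + a \<and> y < p) M"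
  let ?I = "(\<lambda>i. p - 2 * i) ` {1..a div 2}"
  have b: "2 * i \<le> a" if "i \<in> {1..a div 2}" for i using that by auto
  have "size ?N = sum (count ?N) (set_mset ?N)"
    by (rule size_multiset_overloaded_eq)
  also have "\<dots> = sum (count ?N) ?I"
  proof (rule sum.mono_neutral_left)
    show "set_mset ?N \<subseteq> ?I"
    proof
      fix y assume y: "y \<in># ?N"
      then have "even (p - y)" "y < p" "p \<le> y + a" using assms by auto
      then obtain i where i: "p - y = 2 * i" by blast
      then have "y = p - 2 * i" "i \<in> {1..a div 2}" using \<open>y < p\<close> \<open>p \<le> y + a\<close> by auto
      then show "y \<in> ?I" by blast
    qed
  qed (auto simp: not_in_iff)
  also have "\<dots> = (\<Sum>i=1..a div 2. count ?N (p - 2 * i))"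
    using b assms(3) by (subst sum.reindex) (fastforce simp: inj_on_def)+
  also have "\<dots> = (\<Sum>i=1..a div 2. count M (p - 2 * i))"
  proof (rule sum.cong[OF refl])
    fix i assume "i \<in> {1..a div 2}"
    then show "count ?N (p - 2 * i) = count M (p - 2 * i)" using b[of i] assms(3) by auto
  qed
  finally show ?thesis .
qed

text \<open>The row of the box together with its leg: \<open>l ! i\<close> rows of length
  \<open>p - 2 * i\<close> lie in the leg, so \<open>l ! 0\<close> is the number of equal rows
  below. The added \<open>p\<close> is the row itself.\<close>

definition leg_multiset :: "nat \<Rightarrow> nat list \<Rightarrow> nat multiset" where
  "leg_multiset p l = add_mset p (\<Sum>i<length l. replicate_mset (l ! i) (p - 2 * i))"

lemma count_leg_multiset:
  assumes "2 * length l \<le> p + 1" "i < length l"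
  shows "count (leg_multiset p l) (p - 2 * i) = l ! i + (if i = 0 then 1 else 0)"
proof -
  let ?N = "\<Sum>j<length l. replicate_mset (l ! j) (p - 2 * j)"
  have "count ?N (p - 2 * i) = (\<Sum>j<length l. if j = i then l ! j else 0)"
    unfolding count_sum using assms by (intro sum.cong refl) auto
  also have "\<dots> = l ! i" using assms by simp
  finally have "count ?N (p - 2 * i) = l ! i" .
  moreover have "p = p - 2 * i \<longleftrightarrow> i = 0" using assms by auto
  ultimately show ?thesis unfolding leg_multiset_def by (simp only: count_add_mset) simp
qed

lemma set_leg_multiset:
  assumes "l \<noteq> []"
  shows "set_mset (leg_multiset p l) \<subseteq> (\<lambda>i. p - 2 * i) ` {..<length l}"
proof
  fix y assume "y \<in># leg_multiset p l"
  then have "y = p \<or> (\<exists>i<length l. y \<in># replicate_mset (l ! i) (p - 2 * i))"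
    by (auto simp: leg_multiset_def set_mset_sum)
  then show "y \<in> (\<lambda>i. p - 2 * i) ` {..<length l}"
    using assms by (auto simp: image_iff intro: bexI[of _ 0] split: if_splits)
qed

lemma sum_mset_of_sum: "\<Sum>\<^sub># (\<Sum>i\<in>A. f i) = (\<Sum>i\<in>A. \<Sum>\<^sub># (f i))"
  by (induction A rule: infinite_finite_induct) auto

lemma sum_leg_multiset:
  assumes "2 * length l \<le> p + 1"
  shows "int (\<Sum>\<^sub># (leg_multiset p l)) = (int (sum_list l) + 1) * int p - 2 * int (\<Sum>i<length l. i * l ! i)"
proof -
  have "\<Sum>\<^sub># (leg_multiset p l) = p + (\<Sum>i<length l. l ! i * (p - 2 * i))"
    by (simp add: leg_multiset_def sum_mset_of_sum)
  also have "int \<dots> = int p + (\<Sum>i<length l. int (l ! i) * int p - 2 * int (i * l ! i))"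
    using assms by (auto simp: of_nat_diff algebra_simps intro!: sum.cong)
  also have "\<dots> = int p + int (\<Sum>i<length l. l ! i) * int p - 2 * int (\<Sum>i<length l. i * l ! i)"
    by (simp add: sum_subtractf sum_distrib_left sum_distrib_right)
  also have "(\<Sum>i<length l. l ! i) = sum_list l"
    by (simp add: sum_list_sum_nth atLeast0LessThan)
  finally show ?thesis by (simp add: algebra_simps)
qed

text \<open>All entries of \<open>l\<close> but \<open>l ! 0\<close> are dictated by
  \<open>g\<close>, and \<open>l ! 0\<close> plays the role of \<open>r\<close>. The conjunct
  \<open>a < h\<close> rules out the case where \<open>h - 1 - a\<close> truncates to
  \<open>0\<close>.\<close>

lemma card_legs:
  fixes a c :: nat
  shows "card {r. r < c \<and> r + (\<Sum>i=1..f. g i) + a + 1 = h}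
    = card {l \<in> {l. length l = Suc f \<and> sum_list l = h - 1 - a}. a < h \<and> l ! 0 < c \<and> (\<forall>i\<in>{1..f}. l ! i = g i)}"
proof (rule bij_betw_same_card)
  let ?F = "\<lambda>r. r # map (\<lambda>i. g (Suc i)) [0..<f]"
  have s: "sum_list (map (\<lambda>i. g (Suc i)) [0..<f]) = (\<Sum>i=1..f. g i)"
    by (simp add: sum_list_distinct_conv_sum_set sum.shift_bounds_Suc_ivl[symmetric] atLeastLessThanSuc_atLeastAtMost)
  show "bij_betw ?F {r. r < c \<and> r + (\<Sum>i=1..f. g i) + a + 1 = h}
     {l \<in> {l. length l = Suc f \<and> sum_list l = h - 1 - a}. a < h \<and> l ! 0 < c \<and> (\<forall>i\<in>{1..f}. l ! i = g i)}" (is "bij_betw _ ?A ?B")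
  proof (rule bij_betw_byWitness[where f' = "\<lambda>l. l ! 0"])
    have eq: "l = ?F (l ! 0)" if "length l = Suc f" "\<forall>i\<in>{1..f}. l ! i = g i" for l
    proof (rule nth_equalityI)
      fix i assume "i < length l"
      then show "l ! i = ?F (l ! 0) ! i" using that by (cases i) auto
    qed (use that in simp)
    show "\<forall>l\<in>?B. ?F (l ! 0) = l" using eq by auto
    have "?F r ! i = g i" if "i \<in> {1..f}" for r i using that by (cases i) auto
    then show "?F ` ?A \<subseteq> ?B" using s by auto
    show "(\<lambda>l. l ! 0) ` ?B \<subseteq> ?A"
    proof
      fix r assume "r \<in> (\<lambda>l. l ! 0) ` ?B"
      then obtain l where l: "l \<in> ?B" "r = l ! 0" by blast
      then have "sum_list l = r + (\<Sum>i=1..f. g i)" using eq[of l] s by (metis (mono_tags, lifting) mem_Collect_eq sum_list.Cons)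
      then show "r \<in> ?A" using l by auto
    qed
  qed auto
qed

text \<open>For fixed arm \<open>a\<close> the leg is a list of \<open>a div 2 + 1\<close>
  multiplicities with sum \<open>h - 1 - a\<close>. The box row and its leg weigh
  \<open>(h - a) * p\<close> minus twice the weighted sum of \<open>l\<close>, independently of the
  rest of the partition.\<close>

lemma odd_hooks_eq:
  "odd_hooks h n = (\<Sum>a<h. \<Sum>l | length l = Suc (a div 2) \<and> sum_list l = h - 1 - a.
     \<Sum>u=(a + 1) div 2..2*n. odd_count (odd_block (2 * u + 1) (a div 2))
       (int n - int (h - a) * int (2 * u + 1) + 2 * int (\<Sum>i<length l. i * l ! i)))"
proof -
  let ?D = "{M. (\<forall>x\<in>#M. odd x) \<and> \<Sum>\<^sub># M = n}"
  let ?L = "\<lambda>a. {l :: nat list. length l = Suc (a div 2) \<and> sum_list l = h - 1 - a}"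
  let ?c = "\<lambda>a u l. odd_count (odd_block (2 * u + 1) (a div 2))
       (int n - int (h - a) * int (2 * u + 1) + 2 * int (\<Sum>i<length l. i * l ! i))"
  have fin: "finite ?D"
    by (rule finite_subset[OF _ finite_odd_multisets[of "int n" "\<lambda>_. True"]]) auto
  have finL: "finite (?L a)" for a
    by (rule finite_subset[OF _ finite_lists_length_eq[of "{..h}" "Suc (a div 2)"]]) (auto dest: member_le_sum_list)
  have "odd_hooks h n = (\<Sum>la\<in>odd_partitions n. card (hook_triples h (mset la)))"
    unfolding odd_hooks_def
    by (intro sum.cong refl) (auto simp: odd_partitions_def partitions_def count_hook_numbers)
  also have "\<dots> = (\<Sum>M\<in>?D. card (hook_triples h M))"
    by (rule sum.reindex_bij_betw[OF bij_betw_odd_partitions])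
  also have "\<dots> = (\<Sum>M\<in>?D. \<Sum>a<h. \<Sum>u=(a + 1) div 2..2*n.
    card {l \<in> ?L a. l ! 0 < count M (2*u+1) \<and> (\<forall>i\<in>{1..a div 2}. l ! i = count M (2*u+1 - 2*i))})"
  proof (intro sum.cong refl)
    fix M assume M: "M \<in> ?D"
    then have "card (hook_triples h M) = (\<Sum>a<h. \<Sum>u=(a + 1) div 2..2*n.
      card {r. r < count M (2*u+1) \<and> r + size (filter_mset (\<lambda>y. 2*u+1 \<le> y + a \<and> y < 2*u+1) M) + a + 1 = h})"
      by (intro card_hook_triples_odd) auto
    also have "\<dots> = (\<Sum>a<h. \<Sum>u=(a + 1) div 2..2*n.
      card {l \<in> ?L a. l ! 0 < count M (2*u+1) \<and> (\<forall>i\<in>{1..a div 2}. l ! i = count M (2*u+1 - 2*i))})"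
    proof (intro sum.cong refl)
      fix a u assume a: "a \<in> {..<h}" and u: "u \<in> {(a + 1) div 2..2 * n}"
      then have "a < 2 * u + 1" by auto
      then have "size (filter_mset (\<lambda>y. 2*u+1 \<le> y + a \<and> y < 2*u+1) M) = (\<Sum>i=1..a div 2. count M (2*u+1 - 2 * i))"
        using M by (intro size_filter_odd_multiset) auto
      then show "card {r. r < count M (2*u+1) \<and> r + size (filter_mset (\<lambda>y. 2*u+1 \<le> y + a \<and> y < 2*u+1) M) + a + 1 = h}
        = card {l \<in> ?L a. l ! 0 < count M (2*u+1) \<and> (\<forall>i\<in>{1..a div 2}. l ! i = count M (2*u+1 - 2*i))}"
        using a card_legs[of "count M (2*u+1)" "\<lambda>i. count M (2*u+1 - 2*i)" "a div 2" a h] by simp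
    qed
    finally show "card (hook_triples h M) = (\<Sum>a<h. \<Sum>u=(a + 1) div 2..2*n.
      card {l \<in> ?L a. l ! 0 < count M (2*u+1) \<and> (\<forall>i\<in>{1..a div 2}. l ! i = count M (2*u+1 - 2*i))})" .
  qed
  also have "\<dots> = (\<Sum>a<h. \<Sum>u=(a + 1) div 2..2*n. \<Sum>M\<in>?D.
    card {l \<in> ?L a. l ! 0 < count M (2*u+1) \<and> (\<forall>i\<in>{1..a div 2}. l ! i = count M (2*u+1 - 2*i))})"
    by (subst sum.swap) (intro sum.cong refl sum.swap)
  also have "\<dots> = (\<Sum>a<h. \<Sum>u=(a + 1) div 2..2*n. \<Sum>l\<in>?L a. ?c a u l)"
  proof (intro sum.cong refl)
    fix a u assume a: "a \<in> {..<h}" and u: "u \<in> {(a + 1) div 2..2 * n}"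
    let ?p = "2 * u + 1" and ?f = "a div 2"
    have "(\<Sum>M\<in>?D. card {l \<in> ?L a. l ! 0 < count M ?p \<and> (\<forall>i\<in>{1..?f}. l ! i = count M (?p - 2*i))})
        = (\<Sum>l\<in>?L a. card {M \<in> ?D. l ! 0 < count M ?p \<and> (\<forall>i\<in>{1..?f}. l ! i = count M (?p - 2*i))})"
      by (rule sum_card_swap[OF fin finL])
    also have "\<dots> = (\<Sum>l\<in>?L a. ?c a u l)"
    proof (rule sum.cong[OF refl])
      fix l assume l: "l \<in> ?L a"
      let ?R = "leg_multiset ?p l"
      have len: "length l = Suc ?f" "2 * length l \<le> ?p + 1" using l u by auto
      have sR: "set_mset ?R \<subseteq> (\<lambda>i. ?p - 2 * i) ` {..<length l}"
        by (rule set_leg_multiset) (use len in auto)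
      have c0: "count ?R ?p = l ! 0 + 1" using count_leg_multiset[OF len(2), of 0] len by simp
      have ci: "count ?R (?p - 2 * i) = l ! i" if "i \<in> {1..?f}" for i
        using count_leg_multiset[OF len(2), of i] len that by auto
      \<comment> \<open>On the block the multiplicities are exact. At \<open>p\<close> the inclusion
        \<open>?R \<subseteq># M\<close> only asks for at least \<open>l ! 0 + 1\<close>
        copies.\<close>
      have cond: "l ! 0 < count M ?p \<and> (\<forall>i\<in>{1..?f}. l ! i = count M (?p - 2*i))
          \<longleftrightarrow> ?R \<subseteq># M \<and> (\<forall>k\<in>odd_block ?p ?f. count M k = count ?R k)" (is "?lhs \<longleftrightarrow> ?rhs") for M
      proof
        assume lhs: ?lhs
        have "count ?R y \<le> count M y" for y
        proof (cases "y \<in># ?R")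
          case True
          then obtain i where i: "y = ?p - 2 * i" "i < length l" using sR by auto
          show ?thesis
          proof (cases "i = 0")
            case False
            then show ?thesis using i len ci[of i] lhs by auto
          qed (use c0 lhs i in simp)
        qed (simp add: not_in_iff)
        then show ?rhs using lhs ci by (auto simp: odd_block_def subseteq_mset_def)
      next
        assume rhs: ?rhs
        then have "count ?R ?p \<le> count M ?p" by (simp add: subseteq_mset_def)
        then show ?lhs using rhs c0 ci by (auto simp: odd_block_def)
      qed
      have "{M \<in> ?D. l ! 0 < count M ?p \<and> (\<forall>i\<in>{1..?f}. l ! i = count M (?p - 2*i))}
         = {M. (\<forall>x\<in>#M. odd x) \<and> int (\<Sum>\<^sub># M) = int n \<and> ?R \<subseteq># M \<and> (\<forall>k\<in>odd_block ?p ?f. count M k = count ?R k)}"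
        unfolding cond by (auto simp del: of_nat_sum_mset)
      then have "card {M \<in> ?D. l ! 0 < count M ?p \<and> (\<forall>i\<in>{1..?f}. l ! i = count M (?p - 2*i))}
         = card {M. (\<forall>x\<in>#M. odd x) \<and> int (\<Sum>\<^sub># M) = int n \<and> ?R \<subseteq># M \<and> (\<forall>k\<in>odd_block ?p ?f. count M k = count ?R k)}"
        by (rule arg_cong)
      also have "\<dots> = odd_count (odd_block ?p ?f) (int n - int (\<Sum>\<^sub># ?R))"
      proof (rule card_odd_multisets_prescribed)
        have "odd (?p - 2 * i)" if "i < length l" for i
        proof -
          have "?p - 2 * i = 2 * (u - i) + 1" using that len by auto
          then show ?thesis by simp
        qed
        then show "\<forall>x\<in>#?R. odd x" using sR by auto
      qed
      also have "int (\<Sum>\<^sub># ?R) = int (h - a) * int ?p - 2 * int (\<Sum>i<length l. i * l ! i)"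
        unfolding sum_leg_multiset[OF len(2)] using l a by (simp add: of_nat_diff)
      finally show "card {M \<in> ?D. l ! 0 < count M ?p \<and> (\<forall>i\<in>{1..?f}. l ! i = count M (?p - 2*i))} = ?c a u l"
        by (simp add: algebra_simps)
    qed
    finally show "(\<Sum>M\<in>?D. card {l \<in> ?L a. l ! 0 < count M ?p \<and> (\<forall>i\<in>{1..?f}. l ! i = count M (?p - 2*i))})
      = (\<Sum>l\<in>?L a. ?c a u l)" .
  qed
  also have "\<dots> = (\<Sum>a<h. \<Sum>l\<in>?L a. \<Sum>u=(a + 1) div 2..2*n. ?c a u l)"
    by (intro sum.cong refl sum.swap)
  finally show ?thesis .
qed

section \<open>Growth of the partition function\<close>

text \<open>Lets a single function \<open>q\<close> serve both families: its monotonicity is read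
  off from odd parts, its growth from distinct parts.\<close>

lemma distinct_count_empty: "distinct_count {} m = odd_count {} m"
proof (cases "m < 0")
  case True
  then show ?thesis
    by (simp add: distinct_count_def odd_count_def del: of_nat_sum of_nat_sum_mset)
next
  case False
  then obtain n where m: "m = int n" by (metis nonneg_int_cases not_less)
  show ?thesis
    using card_odd_multisets_eq_card_distinct_sets[of n]
    by (simp add: m distinct_count_def odd_count_def of_nat_eq_iff del: of_nat_sum of_nat_sum_mset)
qed

definition q :: "int \<Rightarrow> real" where
  "q m = real (odd_count {} m)"

lemma q_nonneg [simp]: "q m \<ge> 0"
  by (simp add: q_def)

lemma q_neg [simp]: "m < 0 \<Longrightarrow> q m = 0"
  unfolding q_def odd_count_def
  by (simp add: card_eq_0_iff del: of_nat_sum_mset)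

text \<open>Adding a part \<open>1\<close> is injective on multisets of odd parts. Sets of distinct
  parts would offer no such direct map, as \<open>1\<close> may already be present.\<close>

lemma q_step: "q m \<le> q (m + 1)"
  using odd_count_insert[of 1 "{}" "m + 1"] by (simp add: q_def)

lemma q_mono: "m \<le> m' \<Longrightarrow> q m \<le> q m'"
proof (induction m' rule: int_ge_induct)
  case (step i)
  then show ?case using q_step[of i] by linarith
qed simp

definition S :: "int \<Rightarrow> real" where
  "S y = (\<Sum>j<nat y. q (int j))"

lemma S_Suc: "S (y + 1) = S y + q y"
proof (cases "y < 0")
  case False
  then have "nat (y + 1) = Suc (nat y)" by simp
  then show ?thesis using False by (simp add: S_def)
qed (simp add: S_def)

lemma S_nonpos [simp]: "y \<le> 0 \<Longrightarrow> S y = 0"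
  by (simp add: S_def)

lemma S_nonneg [simp]: "S y \<ge> 0"
  by (simp add: S_def sum_nonneg)

lemma S_mono: "y \<le> y' \<Longrightarrow> S y \<le> S y'"
proof (induction y' rule: int_ge_induct)
  case (step i)
  then show ?case using S_Suc[of i] q_nonneg[of i] by linarith
qed simp

lemma S_diff_le: "S (y + int c) - S y \<le> real c * q (y + int c - 1)"
proof (induction c)
  case (Suc c)
  have "S (y + int (Suc c)) = S (y + int c) + q (y + int c)"
    using S_Suc[of "y + int c"] by (simp add: algebra_simps)
  moreover have "real c * q (y + int c - 1) \<le> real c * q (y + int c)"
    by (intro mult_left_mono q_mono) auto
  ultimately show ?case using Suc by (simp add: algebra_simps)
qed simp

lemma S_diff_ge: "real c * q y \<le> S (y + int c) - S y"
proof (induction c)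
  case (Suc c)
  have "S (y + int (Suc c)) = S (y + int c) + q (y + int c)"
    using S_Suc[of "y + int c"] by (simp add: algebra_simps)
  moreover have "q y \<le> q (y + int c)"
    by (intro q_mono) auto
  ultimately show ?case using Suc by (simp add: algebra_simps)
qed simp

text \<open>By monotonicity \<open>c * q y\<close> is at most the sum of \<open>q\<close> over the
  \<open>c\<close> arguments from \<open>y\<close> upwards. For \<open>y = x - c * u\<close> these
  blocks are adjacent, so the sum telescopes.\<close>

lemma sum_q_le: "real c * (\<Sum>u=L..U. q (x - int c * int u)) \<le> S (x + int c - int c * int L)"
proof (cases "L \<le> Suc U")
  case True
  have "real c * (\<Sum>u=L..U. q (x - int c * int u))
      \<le> (\<Sum>u=L..U. S (x - int c * int u + int c) - S (x - int c * int u))"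
    unfolding sum_distrib_left by (intro sum_mono S_diff_ge)
  also have "\<dots> = (\<Sum>u=L..U. (- S (x + int c - int c * int (Suc u))) - (- S (x + int c - int c * int u)))"
    by (intro sum.cong) (auto simp: algebra_simps)
  also have "\<dots> = S (x + int c - int c * int L) - S (x + int c - int c * int (Suc U))"
    using sum_Suc_diff[OF True, of "\<lambda>u. - S (x + int c - int c * int u)"] by simp
  finally show ?thesis using S_nonneg[of "x + int c - int c * int (Suc U)"] by linarith
qed simp

text \<open>Same telescoping with the \<open>c\<close> arguments ending at \<open>x - c * u\<close>.
  The bound \<open>x \<le> c * U\<close> makes the last value of \<open>S\<close> vanish.\<close>

lemma sum_q_ge:
  assumes "c \<ge> 1" "x \<le> int c * int U" "L \<le> Suc U"
  shows "S (x + 1 - int c * int L) \<le> real c * (\<Sum>u=L..U. q (x - int c * int u))"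
proof -
  have "(\<Sum>u=L..U. S (x - int c * int u + 1) - S (x - int c * int u + 1 - int c))
      \<le> real c * (\<Sum>u=L..U. q (x - int c * int u))"
    unfolding sum_distrib_left
  proof (intro sum_mono)
    fix u
    show "S (x - int c * int u + 1) - S (x - int c * int u + 1 - int c) \<le> real c * q (x - int c * int u)"
      using S_diff_le[of "x - int c * int u + 1 - int c" c] by simp
  qed
  moreover have "(\<Sum>u=L..U. S (x - int c * int u + 1) - S (x - int c * int u + 1 - int c))
     = (\<Sum>u=L..U. (- S (x + 1 - int c * int (Suc u))) - (- S (x + 1 - int c * int u)))"
    by (intro sum.cong) (auto simp: algebra_simps)
  moreover have "\<dots> = S (x + 1 - int c * int L) - S (x + 1 - int c * int (Suc U))"
    using sum_Suc_diff[OF assms(3), of "\<lambda>u. - S (x + 1 - int c * int u)"] by simp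
  moreover have "S (x + 1 - int c * int (Suc U)) = 0"
    using assms by (intro S_nonpos) (simp add: algebra_simps)
  ultimately show ?thesis by simp
qed

section \<open>Growth of \<open>q\<close> and its size relative to \<open>S\<close>\<close>

lemma q_pos: "n \<ge> 0 \<Longrightarrow> q n \<ge> 1"
proof -
  assume "n \<ge> 0"
  have "odd_count {} 0 = card {{#} :: nat multiset}"
    unfolding odd_count_def
    by (rule arg_cong[where f = card]) (auto simp: zero_notin_odd_multiset simp del: of_nat_sum_mset, 
        metis even_zero multiset_nonemptyE)
  then have "q 0 = 1" by (simp add: q_def)
  then show ?thesis using q_mono[OF \<open>n \<ge> 0\<close>] by simp
qed

lemma S_pos: "n > 0 \<Longrightarrow> S n > 0"
  using S_Suc[of 0] S_mono[of 1 n] q_pos[of 0] by simp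

text \<open>Every \<open>T \<subseteq> {1..s}\<close> is completed to a set with sum
  \<open>n\<close> by one further part \<open>n - \<Sum>T\<close>, which exceeds \<open>s\<close>;
  hence \<open>T\<close> is recovered by intersecting with \<open>{1..s}\<close>.\<close>

lemma pow2_le_q:
  assumes "s\<^sup>2 + s < n"
  shows "2 ^ s \<le> q (int n)"
proof -
  let ?f = "\<lambda>T. insert (n - \<Sum>T) T"
  have b: "\<Sum>T + s < n" if "T \<subseteq> {1..s}" for T
  proof -
    have "\<Sum>T \<le> card T * s"
      using sum_bounded_above[of T "\<lambda>x. x" s] that by (simp add: subset_iff)
    also have "\<dots> \<le> s * s"
      using card_mono[OF _ that] by simp
    finally show ?thesis using assms by (simp add: power2_eq_square)
  qed
  have n: "n - \<Sum>T \<notin> {0..s}" if "T \<subseteq> {1..s}" for T using b[OF that] by auto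
  have "inj_on ?f (Pow {1..s})"
  proof (rule inj_on_inverseI[where g = "\<lambda>A. A \<inter> {1..s}"])
    fix T assume "T \<in> Pow {1..s}"
    then show "?f T \<inter> {1..s} = T" using n[of T] by auto
  qed
  then have "card (Pow {1..s}) = card (?f ` Pow {1..s})" by (rule card_image[symmetric])
  also have "\<dots> \<le> distinct_count {} (int n)"
    unfolding distinct_count_def
  proof (rule card_mono)
    show "finite {A. finite A \<and> 0 \<notin> A \<and> A \<inter> {} = {} \<and> int (\<Sum>A) = int n}"
      by (rule finite_subset[OF _ finite_distinct_sets[of "int n" "\<lambda>_. True"]]) auto
    show "?f ` Pow {1..s} \<subseteq> {A. finite A \<and> 0 \<notin> A \<and> A \<inter> {} = {} \<and> int (\<Sum>A) = int n}"
    proof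
      fix A assume "A \<in> ?f ` Pow {1..s}"
      then obtain T where T: "T \<subseteq> {1..s}" "A = ?f T" by auto
      then have "finite T" by (auto intro: finite_subset)
      moreover have "n - \<Sum>T \<notin> T" "n - \<Sum>T \<noteq> 0" "0 \<notin> T" using n[OF T(1)] T(1) by auto
      ultimately have "finite A" "0 \<notin> A" "\<Sum>A = n" using b[OF T(1)] T(2) by auto
      then show "A \<in> {A. finite A \<and> 0 \<notin> A \<and> A \<inter> {} = {} \<and> int (\<Sum>A) = int n}"
        by (simp del: of_nat_sum)
    qed
  qed
  finally have "2 ^ s \<le> distinct_count {} (int n)" by (simp add: card_Pow)
  then have "real (2 ^ s) \<le> real (distinct_count {} (int n))" by (simp only: of_nat_le_iff)
  then show ?thesis by (simp add: q_def distinct_count_empty)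
qed

text \<open>Padding with zeros encodes such a set as a list of length exactly \<open>B\<close> over
  \<open>{..n}\<close>.\<close>

lemma card_small_distinct_sets:
  "card {A. finite A \<and> 0 \<notin> A \<and> \<Sum>A = n \<and> card A < B} \<le> (n + 1) ^ B"
proof -
  let ?L = "{xs. set xs \<subseteq> {..n} \<and> length xs = B}"
  have "{A. finite A \<and> 0 \<notin> A \<and> \<Sum>A = n \<and> card A < B} \<subseteq> (\<lambda>xs. set xs - {0}) ` ?L"
  proof
    fix A assume A: "A \<in> {A. finite A \<and> 0 \<notin> A \<and> \<Sum>A = n \<and> card A < B}"
    define xs where "xs = sorted_list_of_set A @ replicate (B - card A) 0"
    have "x \<le> n" if "x \<in> A" for x
      using member_le_sum[of x A "\<lambda>x. x"] that A by simp
    then have "xs \<in> ?L" using A by (auto simp: xs_def)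
    moreover have "A = set xs - {0}" using A by (auto simp: xs_def)
    ultimately show "A \<in> (\<lambda>xs. set xs - {0}) ` ?L" by blast
  qed
  then have "card {A. finite A \<and> 0 \<notin> A \<and> \<Sum>A = n \<and> card A < B} \<le> card ?L"
    by (rule surj_card_le[rotated]) (simp add: finite_lists_length_eq)
  then show ?thesis by (simp add: card_lists_length_eq)
qed

lemma distinct_sets_containing_le:
  assumes "p > 0"
  shows "real (card {A. finite A \<and> 0 \<notin> A \<and> \<Sum>A = n \<and> p \<in> A}) \<le> q (int n - int p)"
proof -
  let ?Z = "{A. finite A \<and> 0 \<notin> A \<and> A \<inter> {} = {} \<and> int (\<Sum>A) = int n - int p}"
  have fin: "finite ?Z"
    by (rule finite_subset[OF _ finite_distinct_sets[of "int n - int p" "\<lambda>_. True"]]) auto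
  have "{A. finite A \<and> 0 \<notin> A \<and> \<Sum>A = n \<and> p \<in> A} \<subseteq> insert p ` ?Z"
  proof
    fix A assume A: "A \<in> {A. finite A \<and> 0 \<notin> A \<and> \<Sum>A = n \<and> p \<in> A}"
    then have "A = insert p (A - {p})" by auto
    moreover have "A - {p} \<in> ?Z" using A by (auto simp: sum.remove)
    ultimately show "A \<in> insert p ` ?Z" by blast
  qed
  then have "card {A. finite A \<and> 0 \<notin> A \<and> \<Sum>A = n \<and> p \<in> A} \<le> distinct_count {} (int n - int p)"
    unfolding distinct_count_def by (rule surj_card_le[OF fin])
  then show ?thesis by (simp add: q_def distinct_count_empty)
qed

text \<open>Double counting of pairs of a set and one of its elements \<open>p\<close>: removing
  \<open>p\<close> leaves a set with sum \<open>n - p\<close>, counted by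
  \<open>q (n - p)\<close>.\<close>

lemma sum_card_distinct_sets_le:
  "(\<Sum>A | finite A \<and> 0 \<notin> A \<and> \<Sum>A = n. real (card A)) \<le> S (int n)"
proof -
  let ?D = "{A. finite A \<and> 0 \<notin> A \<and> \<Sum>A = n}"
  have fin: "finite ?D"
    by (rule finite_subset[OF _ finite_distinct_sets[of "int n" "\<lambda>_. True"]]) auto
  have sub: "A \<subseteq> {1..n}" if "A \<in> ?D" for A
    using that unfolding Collect_subset_interval_sum[symmetric] by simp
  have "(\<Sum>A\<in>?D. real (card A)) = (\<Sum>A\<in>?D. \<Sum>p=1..n. if p \<in> A then 1 else 0)"
  proof (rule sum.cong[OF refl])
    fix A assume "A \<in> ?D"
    then have "{1..n} \<inter> A = A" using sub by auto
    then show "real (card A) = (\<Sum>p=1..n. if p \<in> A then 1 else 0)"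
      by (simp add: sum.If_cases Collect_mem_eq)
  qed
  also have "\<dots> = (\<Sum>p=1..n. \<Sum>A\<in>?D. if p \<in> A then 1 else 0)" by (rule sum.swap)
  also have "\<dots> = (\<Sum>p=1..n. real (card {A. finite A \<and> 0 \<notin> A \<and> \<Sum>A = n \<and> p \<in> A}))"
    using fin by (intro sum.cong refl) (simp add: sum.inter_filter[symmetric])
  also have "\<dots> \<le> (\<Sum>p=1..n. q (int n - int p))"
    by (intro sum_mono distinct_sets_containing_le) simp
  also have "\<dots> \<le> S (int n)"
    using sum_q_le[where c = 1 and L = 1 and U = n and x = "int n"] by simp
  finally show ?thesis .
qed

lemma q_le_S: "real B * q (int n) \<le> S (int n) + real B * (real n + 1) ^ B"
proof -
  let ?D = "{A. finite A \<and> 0 \<notin> A \<and> \<Sum>A = n}"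
  let ?F = "{A. finite A \<and> 0 \<notin> A \<and> \<Sum>A = n \<and> card A < B}"
  have fin: "finite ?D"
    by (rule finite_subset[OF _ finite_distinct_sets[of "int n" "\<lambda>_. True"]]) auto
  have "real B * q (int n) = (\<Sum>A\<in>?D. real B)"
    unfolding q_def distinct_count_empty[symmetric] distinct_count_def
    by (simp add: of_nat_eq_iff del: of_nat_sum)
  also have "\<dots> \<le> (\<Sum>A\<in>?D. real (card A) + (if card A < B then real B else 0))"
    by (intro sum_mono) auto
  also have "\<dots> = (\<Sum>A\<in>?D. real (card A)) + real B * real (card ?F)"
    using fin by (simp add: sum.distrib sum.inter_filter[symmetric])
  also have "\<dots> \<le> S (int n) + real B * real ((n + 1) ^ B)"
    by (intro add_mono sum_card_distinct_sets_le mult_left_mono)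
      (simp_all only: of_nat_le_iff card_small_distinct_sets of_nat_0_le_iff)
  finally show ?thesis by (simp add: add.commute)
qed

lemma poly_over_q_tendsto_0: "(\<lambda>n. (real n + 1) ^ B / q (int n)) \<longlonglongrightarrow> 0"
proof (rule tendsto_sandwich[OF _ _ tendsto_const])
  show "(\<lambda>n::nat. (real n + 1) ^ B / 2 powr (sqrt (real n) - 2)) \<longlonglongrightarrow> 0"
    by real_asymp
  show "\<forall>\<^sub>F n in sequentially. 0 \<le> (real n + 1) ^ B / q (int n)"
    by simp
  show "\<forall>\<^sub>F n in sequentially. (real n + 1) ^ B / q (int n) \<le> (real n + 1) ^ B / 2 powr (sqrt (real n) - 2)"
    using eventually_ge_at_top[of 1]
  proof eventually_elim
    case (elim n)
    \<comment> \<open>Then \<open>s\<^sup>2 + s < (s + 1)\<^sup>2 \<le> n\<close>, and rounding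
      costs at most \<open>2\<close> in the exponent compared with \<open>sqrt n\<close>.\<close>
    define s where "s = nat \<lfloor>sqrt (real n)\<rfloor> - 1"
    have "sqrt (real n) \<ge> 1" using elim by simp
    then have r: "nat \<lfloor>sqrt (real n)\<rfloor> \<ge> 1" by linarith
    then have s1: "real s = of_int \<lfloor>sqrt (real n)\<rfloor> - 1" unfolding s_def by linarith
    then have "real s + 1 \<le> sqrt (real n)" by linarith
    then have "(real s + 1)\<^sup>2 \<le> (sqrt (real n))\<^sup>2" by (intro power_mono) auto
    then have "(real s + 1)\<^sup>2 \<le> real n" by simp
    then have "real ((s + 1)\<^sup>2) \<le> real n" by (simp add: add.commute)
    then have "(s + 1)\<^sup>2 \<le> n" by (simp only: of_nat_le_iff)
    then have "2 ^ s \<le> q (int n)" by (intro pow2_le_q) (simp add: power2_eq_square)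
    moreover have "2 powr (sqrt (real n) - 2) \<le> 2 powr real s"
      using s1 by (intro powr_mono) linarith+
    ultimately have "2 powr (sqrt (real n) - 2) \<le> q (int n)" by (simp add: powr_realpow)
    then show ?case by (intro divide_left_mono) (auto intro!: mult_pos_pos q_pos[THEN less_le_trans[OF zero_less_one]])
  qed
qed

text \<open>A partition into distinct parts with at least \<open>B\<close> parts is counted at least \<open>B\<close> times in
  \<open>S n\<close>, once for each part that can be removed; all others are polynomially few.\<close>

lemma q_over_S_tendsto_0: "(\<lambda>n. q (int n) / S (int n)) \<longlonglongrightarrow> 0"
proof (rule LIMSEQ_I)
  fix r :: real assume r: "r > 0"
  \<comment> \<open>The polynomial error will absorb half of \<open>B * q n\<close>; the other half
    gives \<open>q n / S n \<le> 2 / B < r\<close>.\<close>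
  obtain B :: nat where B: "real B > 2 / r" using reals_Archimedean2 by blast
  then have Bpos: "real B > 0" using r by (meson divide_pos_pos less_trans zero_less_numeral)
  have "\<forall>\<^sub>F n in sequentially. (real n + 1) ^ B / q (int n) < 1 / 2"
    using poly_over_q_tendsto_0[of B] by (rule order_tendstoD) simp
  then have "\<forall>\<^sub>F n in sequentially. norm (q (int n) / S (int n) - 0) < r"
    using eventually_gt_at_top[of 0]
  proof eventually_elim
    case (elim n)
    have q: "q (int n) \<ge> 1" by (rule q_pos) simp
    then have "(real n + 1) ^ B \<le> q (int n) / 2" using elim by (simp add: field_simps)
    then have "real B * (real n + 1) ^ B \<le> real B * (q (int n) / 2)" using Bpos by (intro mult_left_mono) auto
    then have "real B * q (int n) / 2 \<le> S (int n)" using q_le_S[of B n] by simp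
    moreover have "2 / r * q (int n) < real B * q (int n)" using B q by (intro mult_strict_right_mono) auto
    ultimately have "q (int n) / r < S (int n)" by simp
    then show ?case using r S_pos[of "int n"] elim by (simp add: field_simps)
  qed
  then show "\<exists>no. \<forall>n\<ge>no. norm (q (int n) / S (int n) - 0) < r"
    unfolding eventually_sequentially .
qed

section \<open>Shift invariance of \<open>S\<close> and equidistributed sums of
  \<open>q\<close>\<close>

lemma S_shift_Suc: "(\<lambda>n. S (int n + int d) / S (int n)) \<longlonglongrightarrow> 1"
proof (induction d)
  case 0
  have "\<forall>\<^sub>F n in sequentially. 1 = S (int n + int 0) / S (int n)"
    using eventually_gt_at_top[of 0]
    by eventually_elim (use S_pos in \<open>simp add: less_imp_neq[symmetric]\<close>)
  then show ?case by (rule Lim_transform_eventually[OF tendsto_const])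
next
  case (Suc d)
  have "(\<lambda>n. 1 + q (int (n + d)) / S (int (n + d))) \<longlonglongrightarrow> 1 + 0"
    by (intro tendsto_intros LIMSEQ_ignore_initial_segment[OF q_over_S_tendsto_0])
  then have "(\<lambda>n. (1 + q (int (n + d)) / S (int (n + d))) * (S (int n + int d) / S (int n))) \<longlonglongrightarrow> (1 + 0) * 1"
    by (intro tendsto_mult Suc)
  moreover have "\<forall>\<^sub>F n in sequentially. (1 + q (int (n + d)) / S (int (n + d))) * (S (int n + int d) / S (int n))
      = S (int n + int (Suc d)) / S (int n)"
    using eventually_gt_at_top[of 0]
  proof eventually_elim
    case (elim n)
    have "S (int n + int (Suc d)) = S (int n + int d) + q (int n + int d)"
      using S_Suc[of "int n + int d"] by (simp add: algebra_simps)
    moreover have "S (int n + int d) > 0" "S (int n) > 0" using elim by (auto intro!: S_pos)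
    ultimately show ?case by (simp add: field_simps)
  qed
  ultimately show ?case using Lim_transform_eventually by fastforce
qed

lemma S_shift: "(\<lambda>n. S (int n + e) / S (int n)) \<longlonglongrightarrow> 1"
proof (cases "e \<ge> 0")
  case True
  then show ?thesis using S_shift_Suc[of "nat e"] by simp
next
  case False
  define d where "d = nat (- e)"
  have e: "e = - int d" using False by (simp add: d_def)
  \<comment> \<open>A negative shift is the reciprocal of a positive one, up to moving the index by
    \<open>d\<close>.\<close>
  have "(\<lambda>n. inverse (S (int n + int d) / S (int n))) \<longlonglongrightarrow> inverse 1"
    by (intro tendsto_inverse S_shift_Suc) simp
  then have "(\<lambda>n. S (int (n + d) + e) / S (int (n + d))) \<longlonglongrightarrow> 1"
    by (simp add: e)
  then show ?thesis by (rule LIMSEQ_offset)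
qed

text \<open>The telescoping bounds differ only by a bounded shift in the argument of
  \<open>S\<close>, which disappears in the limit. Once \<open>n \<ge> d\<close>, the range up to
  \<open>2 * n\<close> contains all nonzero terms.\<close>

lemma sum_q_tendsto:
  assumes "c \<ge> 1"
  shows "(\<lambda>n. (\<Sum>u=L..2*n. q (int n - int c * int u + d)) / S (int n)) \<longlonglongrightarrow> 1 / real c"
proof (rule tendsto_sandwich)
  show "(\<lambda>n. S (int n + (d + 1 - int c * int L)) / S (int n) / real c) \<longlonglongrightarrow> 1 / real c"
    "(\<lambda>n. S (int n + (d + int c - int c * int L)) / S (int n) / real c) \<longlonglongrightarrow> 1 / real c"
    using assms by (auto simp del: of_nat_diff divide_divide_eq_left intro!: tendsto_divide S_shift tendsto_const)
  have eq: "q (int n - int c * int u + d) = q ((int n + d) - int c * int u)" for n u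
    by (simp add: algebra_simps)
  show "\<forall>\<^sub>F n in sequentially. S (int n + (d + 1 - int c * int L)) / S (int n) / real c
      \<le> (\<Sum>u=L..2*n. q (int n - int c * int u + d)) / S (int n)"
    using eventually_ge_at_top[of "max L (nat d)"]
  proof eventually_elim
    case (elim n)
    have "int n + d \<le> 1 * int (2 * n)" using elim by linarith
    also have "\<dots> \<le> int c * int (2 * n)" using assms by (intro mult_right_mono) auto
    finally have "S (int n + d + 1 - int c * int L) \<le> real c * (\<Sum>u=L..2*n. q (int n + d - int c * int u))"
      using elim assms by (intro sum_q_ge) auto
    then have "S (int n + (d + 1 - int c * int L)) / real c \<le> (\<Sum>u=L..2*n. q (int n + d - int c * int u))"
      using assms by (simp add: field_simps)
    then show ?case unfolding eq
      using divide_right_mono[OF _ S_nonneg[of "int n"]] by (simp add: divide_divide_eq_left mult.commute) fastforce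
  qed
  show "\<forall>\<^sub>F n in sequentially. (\<Sum>u=L..2*n. q (int n - int c * int u + d)) / S (int n)
      \<le> S (int n + (d + int c - int c * int L)) / S (int n) / real c"
  proof (intro always_eventually allI)
    fix n
    have "(\<Sum>u=L..2*n. q (int n + d - int c * int u)) \<le> S (int n + (d + int c - int c * int L)) / real c"
      using sum_q_le[where c = c and L = L and U = "2 * n" and x = "int n + d"] assms by (simp add: field_simps)
    then show "(\<Sum>u=L..2*n. q (int n - int c * int u + d)) / S (int n)
      \<le> S (int n + (d + int c - int c * int L)) / S (int n) / real c"
      unfolding eq
      using divide_right_mono[OF _ S_nonneg[of "int n"]] by (simp add: divide_divide_eq_left mult.commute) fastforce
  qed
qed

section \<open>Limits\<close>

text \<open>The factor \<open>x ^ (c - 1)\<close> stands for the multiple \<open>c * p\<close>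
  already subtracted, and each of the \<open>k\<close> forbidden parts contributes a factor
  \<open>1 / (1 + x)\<close>.\<close>

definition limit_weight :: "nat \<Rightarrow> nat \<Rightarrow> real" where
  "limit_weight c k = integral {0..1} (\<lambda>x. x ^ (c - 1) / (1 + x) ^ k)"

lemma limit_weight_integrable: "(\<lambda>x. x ^ c / (1 + x) ^ k :: real) integrable_on {0..1}"
  by (intro integrable_continuous_interval continuous_intros) auto

lemma limit_weight_0:
  assumes "c \<ge> 1"
  shows "limit_weight c 0 = 1 / real c"
proof -
  have "((\<lambda>x. x ^ (c - 1)) has_integral 1 ^ c / real c - 0 ^ c / real c) {0..1}"
  proof (rule fundamental_theorem_of_calculus)
    fix x :: real
    have "((\<lambda>x. x ^ c / real c) has_real_derivative x ^ (c - 1)) (at x within {0..1})"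
      using assms by (auto intro!: derivative_eq_intros)
    then show "((\<lambda>x. x ^ c / real c) has_vector_derivative x ^ (c - 1)) (at x within {0..1})"
      by (simp add: has_real_derivative_iff_has_vector_derivative)
  qed simp
  then have "integral {0..1} (\<lambda>x. x ^ (c - 1)) = 1 ^ c / real c - 0 ^ c / real c"
    by (rule integral_unique)
  then show ?thesis using assms by (simp add: limit_weight_def)
qed

text \<open>Mirrors \<open>distinct_count_insert\<close>: a part taken out near \<open>p\<close>
  raises \<open>c\<close> by one, that is, multiplies the integrand by \<open>x\<close>.\<close>

lemma limit_weight_Suc:
  assumes "c \<ge> 1"
  shows "limit_weight c (Suc k) = limit_weight c k - limit_weight (Suc c) (Suc k)"
proof -
  have "limit_weight c (Suc k) + limit_weight (Suc c) (Suc k)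
      = integral {0..1} (\<lambda>x. x ^ (c - 1) / (1 + x) ^ Suc k + x ^ c / (1 + x) ^ Suc k)"
    unfolding limit_weight_def diff_Suc_1
    by (rule integral_add[symmetric]) (rule limit_weight_integrable)+
  also have "\<dots> = limit_weight c k"
    unfolding limit_weight_def
  proof (rule integral_cong)
    fix x :: real assume x: "x \<in> {0..1}"
    have "x ^ c = x * x ^ (c - 1)" using assms by (cases c) auto
    then have "x ^ (c - 1) / (1 + x) ^ Suc k + x ^ c / (1 + x) ^ Suc k = (1 + x) * x ^ (c - 1) / ((1 + x) * (1 + x) ^ k)"
      by (simp add: add_divide_distrib[symmetric] algebra_simps)
    then show "x ^ (c - 1) / (1 + x) ^ Suc k + x ^ c / (1 + x) ^ Suc k = x ^ (c - 1) / (1 + x) ^ k"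
      using x by simp
  qed
  finally show ?thesis by simp
qed

lemma limit_weight_nonneg: "limit_weight c k \<ge> 0"
  unfolding limit_weight_def by (rule integral_nonneg[OF limit_weight_integrable]) auto

lemma limit_weight_le:
  assumes "c \<ge> 1"
  shows "limit_weight c k \<le> 1 / real c"
proof -
  have "limit_weight c k \<le> limit_weight c 0"
    unfolding limit_weight_def
  proof (rule integral_le[OF limit_weight_integrable limit_weight_integrable])
    fix x :: real assume "x \<in> {0..1}"
    then show "x ^ (c - 1) / (1 + x) ^ k \<le> x ^ (c - 1) / (1 + x) ^ 0"
      by (simp add: divide_le_eq mult_le_cancel_left1 one_le_power)
  qed
  then show ?thesis using limit_weight_0[OF assms] by simp
qed

text \<open>Parts are forbidden one at a time. Since \<open>p - k\<close> is within a bounded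
  distance of \<open>p\<close>, removing it turns \<open>c\<close> into \<open>Suc c\<close> and
  \<open>d\<close> into \<open>d + k\<close>, and the limit does not depend on \<open>d\<close>. The
  assumption \<open>k \<le> L\<close> keeps all these parts positive.\<close>

lemma distinct_sum_tendsto:
  assumes "k \<le> L" "c \<ge> 1"
  shows "(\<lambda>n. (\<Sum>p=L..2*n. real (distinct_count (top_block p k) (int n - int c * int p + d))) / S (int n))
    \<longlonglongrightarrow> limit_weight c k"
  using assms
proof (induction k arbitrary: c d)
  case 0
  have "top_block p 0 = {}" for p
    by (auto simp: top_block_def)
  then have "real (distinct_count (top_block p 0) m) = q m" for p m
    by (simp add: q_def distinct_count_empty)
  then show ?case using sum_q_tendsto[where c = c and L = L and d = d] 0 by (simp add: limit_weight_0)
next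
  case (Suc k)
  define Y where "Y = (\<lambda>c d n. (\<Sum>p=L..2*n. real (distinct_count (top_block p k) (int n - int c * int p + d))) / S (int n))"
  define X where "X = (\<lambda>c d n. (\<Sum>p=L..2*n. real (distinct_count (top_block p (Suc k)) (int n - int c * int p + d))) / S (int n))"
  have Y: "Y c d \<longlonglongrightarrow> limit_weight c k" if "c \<ge> 1" for c d
    unfolding Y_def using Suc that by simp
  have X_nonneg: "X c d n \<ge> 0" for c d n
    unfolding X_def by (simp add: sum_nonneg)
  have rec: "X c d n = Y c d n - X (Suc c) (d + int k) n" for c d n
  proof -
    have "real (distinct_count (top_block p (Suc k)) (int n - int c * int p + d))
        = real (distinct_count (top_block p k) (int n - int c * int p + d))
        - real (distinct_count (top_block p (Suc k)) (int n - int (Suc c) * int p + (d + int k)))"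
      if "p \<in> {L..2*n}" for p
    proof -
      have p: "p > k" using that Suc by simp
      have b: "insert (p - k) (top_block p k) = top_block p (Suc k)"
        using p by (auto simp: top_block_def)
      have e: "int n - int c * int p + d - int (p - k) = int n - int (Suc c) * int p + (d + int k)"
        using p by (simp add: of_nat_diff algebra_simps)
      have "p - k > 0" "p - k \<notin> top_block p k" using p by (auto simp: top_block_def)
      from distinct_count_insert[OF this, of "int n - int c * int p + d"]
      show ?thesis unfolding b e by simp
    qed
    then have "(\<Sum>p=L..2*n. real (distinct_count (top_block p (Suc k)) (int n - int c * int p + d)))
       = (\<Sum>p=L..2*n. real (distinct_count (top_block p k) (int n - int c * int p + d))
        - real (distinct_count (top_block p (Suc k)) (int n - int (Suc c) * int p + (d + int k))))"
      by (rule sum.cong[OF refl])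
    then show ?thesis unfolding X_def Y_def by (simp add: sum_subtractf diff_divide_distrib)
  qed
  \<comment> \<open>Unfolding the recurrence \<open>J\<close> times leaves a remainder of size at most \<open>1 / (c + J)\<close>.\<close>
  have est: "\<forall>\<^sub>F n in sequentially. \<bar>X c d n - limit_weight c (Suc k)\<bar> < 1 / real (c + J) + e"
    if "c \<ge> 1" "e > 0" for c d J e
    using that
  proof (induction J arbitrary: c d e)
    \<comment> \<open>Both quantities are nonnegative. \<open>X\<close> is at most \<open>Y\<close>,
      whose limit is at most \<open>1 / c\<close>, and the weight is at most \<open>1 / c\<close>
      too.\<close>
    case 0
    have "\<forall>\<^sub>F n in sequentially. Y c d n < 1 / real c + e"
      using Y[of c d] limit_weight_le[of c k] 0 by (intro order_tendstoD(2)) auto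
    then show ?case
    proof eventually_elim
      case (elim n)
      then have "X c d n < 1 / real c + e"
        using rec[of c d n] X_nonneg[of "Suc c" "d + int k" n] by linarith
      then show ?case
        using X_nonneg[of c d n] limit_weight_nonneg[of c "Suc k"] limit_weight_le[of c "Suc k"] 0
        by (simp add: abs_less_iff)
    qed
  next
    case (Suc J)
    have "\<forall>\<^sub>F n in sequentially. \<bar>X (Suc c) (d + int k) n - limit_weight (Suc c) (Suc k)\<bar> < 1 / real (Suc c + J) + e / 2"
      using Suc.prems by (intro Suc.IH) auto
    moreover have "\<forall>\<^sub>F n in sequentially. dist (Y c d n) (limit_weight c k) < e / 2"
      using Y[of c d] Suc.prems by (intro tendstoD) auto
    ultimately show ?case
    proof eventually_elim
      case (elim n)
      have "X c d n - limit_weight c (Suc k)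
          = (Y c d n - limit_weight c k) - (X (Suc c) (d + int k) n - limit_weight (Suc c) (Suc k))"
        using rec[of c d n] limit_weight_Suc[of c k] Suc.prems by simp
      then have "\<bar>X c d n - limit_weight c (Suc k)\<bar> < 1 / real (Suc c + J) + e"
        using elim unfolding dist_real_def by linarith
      then show ?case by simp
    qed
  qed
  have "X c d \<longlonglongrightarrow> limit_weight c (Suc k)"
  proof (rule tendstoI)
    fix e :: real assume e: "e > 0"
    obtain J :: nat where J: "2 / e < real J" using reals_Archimedean2 by blast
    then have "real (c + J) > 2 / e" by simp
    then have "1 / real (c + J) < e / 2" using e Suc.prems
      by (simp add: field_simps)
    with est[of c "e / 2" d J] e Suc.prems
    show "\<forall>\<^sub>F n in sequentially. dist (X c d n) (limit_weight c (Suc k)) < e"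
      by (auto simp: dist_real_def elim!: eventually_mono)
  qed
  then show ?case unfolding X_def .
qed

text \<open>Half the Beta integral of \<open>x ^ (c - 1) * (1 - x) ^ f\<close> over the unit
  interval. The half arises because \<open>p\<close> runs through odd numbers only, in steps of
  two.\<close>

definition odd_weight :: "nat \<Rightarrow> nat \<Rightarrow> real" where
  "odd_weight c f = fact (c - 1) * fact f / (2 * fact (c + f))"

lemma odd_weight_Suc:
  assumes "c \<ge> 1"
  shows "odd_weight c (Suc f) = odd_weight c f - odd_weight (Suc c) f"
proof -
  obtain b where c: "c = Suc b" using assms by (cases c) auto
  show ?thesis unfolding c odd_weight_def
    by (simp add: divide_simps) (simp add: algebra_simps)
qed

text \<open>Here the recurrence in \<open>f\<close> ends after finitely many steps, so limits pass
  through it without any remainder estimate.\<close>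

lemma odd_sum_tendsto:
  assumes "f \<le> L" "c \<ge> 1"
  shows "(\<lambda>n. (\<Sum>u=L..2*n. real (odd_count (odd_block (2 * u + 1) f) (int n - int c * int (2 * u + 1) + d))) / S (int n))
    \<longlonglongrightarrow> odd_weight c f"
  using assms
proof (induction f arbitrary: c d)
  case 0
  have "real (odd_count (odd_block (2 * u + 1) 0) (int n - int c * int (2 * u + 1) + d))
      = q (int n - int (2 * c) * int u + (d - int c))" for u n
    by (simp add: odd_block_def q_def algebra_simps)
  moreover have "odd_weight c 0 = 1 / real (2 * c)"
    using 0 by (cases c) (auto simp: odd_weight_def)
  ultimately show ?case using sum_q_tendsto[where c = "2 * c" and L = L and d = "d - int c"] 0 by simp
next
  case (Suc f)
  let ?g = "\<lambda>c d f n u. real (odd_count (odd_block (2 * u + 1) f) (int n - int c * int (2 * u + 1) + d))"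
  have rec: "?g c d (Suc f) n u = ?g c d f n u - ?g (Suc c) (d + 2 * int (Suc f)) f n u" if "u \<in> {L..2*n}" for n u
  proof -
    have u: "Suc f \<le> u" using that Suc by simp
    have b: "insert (2 * u + 1 - 2 * Suc f) (odd_block (2 * u + 1) f) = odd_block (2 * u + 1) (Suc f)"
      by (simp add: odd_block_def atLeastAtMostSuc_conv)
    have "2 * u + 1 - 2 * Suc f = 2 * (u - Suc f) + 1" using u by simp
    then have o: "odd (2 * u + 1 - 2 * Suc f)" by simp
    have notin: "2 * u + 1 - 2 * Suc f \<notin> odd_block (2 * u + 1) f"
      using u by (auto simp: odd_block_def)
    have e: "int n - int c * int (2 * u + 1) + d - int (2 * u + 1 - 2 * Suc f)
        = int n - int (Suc c) * int (2 * u + 1) + (d + 2 * int (Suc f))"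
      using u by (simp add: of_nat_diff algebra_simps)
    from odd_count_insert[OF o notin, of "int n - int c * int (2 * u + 1) + d"]
    show ?thesis unfolding b e by simp
  qed
  have eq: "(\<Sum>u=L..2*n. ?g c d (Suc f) n u) / S (int n)
      = (\<Sum>u=L..2*n. ?g c d f n u) / S (int n) - (\<Sum>u=L..2*n. ?g (Suc c) (d + 2 * int (Suc f)) f n u) / S (int n)" for n
  proof -
    have "(\<Sum>u=L..2*n. ?g c d (Suc f) n u) = (\<Sum>u=L..2*n. ?g c d f n u - ?g (Suc c) (d + 2 * int (Suc f)) f n u)"
      by (rule sum.cong[OF refl rec])
    then show ?thesis by (simp only: sum_subtractf diff_divide_distrib)
  qed
  show ?case unfolding eq odd_weight_Suc[OF Suc.prems(2)]
    using Suc.prems by (intro tendsto_diff Suc.IH) auto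
qed

section \<open>Limits of the normalized hook counts\<close>

definition odd_limit :: "nat \<Rightarrow> real" where
  "odd_limit h = (\<Sum>a<h. 1 / (2 * real (h - a + a div 2)))"

definition distinct_limit :: "nat \<Rightarrow> real" where
  "distinct_limit h = (\<Sum>a<h. real (a choose (h - 1 - a)) * limit_weight (h - a) (a + 1))"

lemma odd_hooks_tendsto: "(\<lambda>n. real (odd_hooks h n) / S (int n)) \<longlonglongrightarrow> odd_limit h"
proof -
  let ?L = "\<lambda>a. {l :: nat list. length l = Suc (a div 2) \<and> sum_list l = h - 1 - a}"
  have lim: "(\<lambda>n. \<Sum>a<h. \<Sum>l\<in>?L a. (\<Sum>u=(a + 1) div 2..2*n. real (odd_count (odd_block (2 * u + 1) (a div 2))
       (int n - int (h - a) * int (2 * u + 1) + 2 * int (\<Sum>i<length l. i * l ! i)))) / S (int n))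
    \<longlonglongrightarrow> (\<Sum>a<h. \<Sum>l\<in>?L a. odd_weight (h - a) (a div 2))"
    by (intro tendsto_sum odd_sum_tendsto) auto
  have "(\<Sum>l\<in>?L a. odd_weight (h - a) (a div 2)) = 1 / (2 * real (h - a + a div 2))" if "a < h" for a
  proof -
    define t where "t = h - Suc a"
    then have t: "h - a = Suc t" using that by simp
    then have t': "h - 1 - a = t" by simp
    \<comment> \<open>The number of legs is a binomial coefficient which cancels the factorials of
      the weight up to the factor \<open>1 / (2 * (h - a + a div 2))\<close>.\<close>
    have "card (?L a) = (t + a div 2) choose t"
      using card_length_sum_list[of "Suc (a div 2)" t] t' by simp
    moreover have "real ((t + a div 2) choose t) * odd_weight (Suc t) (a div 2) = 1 / (2 * real (Suc t + a div 2))"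
      by (simp add: odd_weight_def binomial_fact divide_simps)
    ultimately show ?thesis using t by (simp only: sum_constant)
  qed
  then have "(\<Sum>a<h. \<Sum>l\<in>?L a. odd_weight (h - a) (a div 2)) = odd_limit h"
    unfolding odd_limit_def by (intro sum.cong refl) blast
  with lim show ?thesis
    by (simp only: odd_hooks_eq of_nat_sum sum_divide_distrib)
qed

lemma distinct_hooks_tendsto: "(\<lambda>n. real (distinct_hooks h n) / S (int n)) \<longlonglongrightarrow> distinct_limit h"
proof -
  let ?T = "\<lambda>a. {T. T \<subseteq> {1..a} \<and> card T = h - 1 - a}"
  have "(\<lambda>n. \<Sum>a<h. \<Sum>T\<in>?T a. (\<Sum>p=a+1..2*n. real (distinct_count (top_block p (a + 1))
       (int n - int (h - a) * int p + int (\<Sum>T)))) / S (int n))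
    \<longlonglongrightarrow> (\<Sum>a<h. \<Sum>T\<in>?T a. limit_weight (h - a) (a + 1))"
    by (intro tendsto_sum distinct_sum_tendsto) auto
  moreover have "(\<Sum>a<h. \<Sum>T\<in>?T a. limit_weight (h - a) (a + 1)) = distinct_limit h"
    unfolding distinct_limit_def by (simp add: n_subsets)
  ultimately show ?thesis
    by (simp only: distinct_hooks_eq of_nat_sum sum_divide_distrib)
qed

section \<open>Comparison of the two limits\<close>

lemma odd_limit_ge:
  assumes "h \<ge> 2"
  shows "odd_limit h \<ge> 4 / 7"
proof -
  define m :: real where "m = (3 * real h + 1) / 4"
  have m: "m > 0" by (simp add: m_def)
  \<comment> \<open>Tangent line of \<open>1 / z\<close> at the average \<open>m\<close> of the numbers \<open>h - a / 2\<close>.\<close>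
  have "(2 * m - (real h - real a / 2)) / (2 * m\<^sup>2) \<le> 1 / (2 * real (h - a + a div 2))" if "a < h" for a
  proof -
    let ?z = "real (h - a + a div 2)"
    have z: "?z > 0" "?z \<le> real h - real a / 2"
    proof -
      show "?z > 0" using that by simp
      have "real (2 * (a div 2)) \<le> real a" unfolding of_nat_le_iff by simp
      then show "?z \<le> real h - real a / 2" using that by (simp add: of_nat_diff)
    qed
    have "(2 * m - ?z) * ?z \<le> m\<^sup>2" using zero_le_power2[of "m - ?z"] by (simp add: power2_eq_square algebra_simps)
    then have "(2 * m - ?z) / (2 * m\<^sup>2) \<le> 1 / (2 * ?z)" using z m by (simp add: field_simps)
    moreover have "(2 * m - (real h - real a / 2)) / (2 * m\<^sup>2) \<le> (2 * m - ?z) / (2 * m\<^sup>2)"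
      using z by (intro divide_right_mono) auto
    ultimately show ?thesis by linarith
  qed
  then have "(\<Sum>a<h. (2 * m - (real h - real a / 2)) / (2 * m\<^sup>2)) \<le> odd_limit h"
    unfolding odd_limit_def by (intro sum_mono) auto
  moreover have "(\<Sum>a<h. (2 * m - (real h - real a / 2)) / (2 * m\<^sup>2)) = real h / (2 * m)"
  proof -
    have "(\<Sum>a<h. real a) = real h * (real h - 1) / 2"
      by (induction h) (auto simp: field_simps)
    moreover have "(\<Sum>a<h. 2 * m - (real h - real a / 2)) = (\<Sum>a<h. (2 * m - real h) + 1 / 2 * real a)"
      by (intro sum.cong) auto
    then have "(\<Sum>a<h. 2 * m - (real h - real a / 2)) = real h * (2 * m - real h) + 1 / 2 * (\<Sum>a<h. real a)"
      unfolding sum.distrib sum_distrib_left[symmetric] by simp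
    ultimately have "(\<Sum>a<h. 2 * m - (real h - real a / 2)) = real h * m"
      by (simp add: m_def field_simps)
    then show ?thesis using m by (simp add: sum_divide_distrib[symmetric] power2_eq_square)
  qed
  \<comment> \<open>The bound equals \<open>2 * h / (3 * h + 1)\<close>, which increases with
    \<open>h\<close> and is \<open>4 / 7\<close> at \<open>h = 2\<close>.\<close>
  moreover have "4 / 7 \<le> real h / (2 * m)" using assms by (simp add: m_def field_simps)
  ultimately show ?thesis by linarith
qed

text \<open>The single term \<open>a = h - 1\<close> suffices: its binomial coefficient is
  \<open>1\<close> and its integrand is at least \<open>1 / 2 ^ h\<close>. Positivity makes the
  quotient of limits meaningful.\<close>

lemma distinct_limit_pos:
  assumes "h \<ge> 1"
  shows "distinct_limit h > 0"
proof -
  have "(1::real) / 2 ^ h = integral {0..1} (\<lambda>x::real. 1 / 2 ^ h)" by simp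
  also have "\<dots> \<le> limit_weight 1 h"
    unfolding limit_weight_def
  proof (rule integral_le[OF _ limit_weight_integrable])
    fix x :: real assume "x \<in> {0..1}"
    then show "1 / 2 ^ h \<le> x ^ (1 - 1) / (1 + x) ^ h"
      by (auto intro!: divide_left_mono power_mono)
  qed auto
  finally have "0 < limit_weight 1 h" by (smt (verit) zero_less_divide_1_iff zero_less_power)
  also have "\<dots> = real ((h - 1) choose (h - 1 - (h - 1))) * limit_weight (h - (h - 1)) (h - 1 + 1)"
    using assms by simp
  also have "\<dots> \<le> distinct_limit h"
    unfolding distinct_limit_def
    by (rule member_le_sum[of "h - 1" "{..<h}"]) (use assms in \<open>auto simp: limit_weight_nonneg\<close>)
  finally show ?thesis .
qed

text \<open>The integrand of \<open>distinct_limit (m + 1)\<close>. The recurrence below exhibits each value as a convex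
  combination of the two preceding ones, so two initial values bound the whole sequence.\<close>

definition renewal :: "nat \<Rightarrow> real \<Rightarrow> real" where
  "renewal m x = (\<Sum>a\<le>m. real (a choose (m - a)) * (x ^ (m - a) / (1 + x) ^ Suc a))"

text \<open>The term \<open>a = 0\<close> vanishes. After shifting \<open>a\<close> by one, Pascal's
  rule splits each binomial coefficient into one belonging to index \<open>m + 1\<close> and one
  belonging to index \<open>m\<close>.\<close>

lemma renewal_Suc_Suc: "renewal (Suc (Suc m)) x = (renewal (Suc m) x + x * renewal m x) / (1 + x)"
proof -
  have "renewal (Suc (Suc m)) x = (\<Sum>a\<le>Suc m. real (Suc a choose (Suc m - a)) * (x ^ (Suc m - a) / (1 + x) ^ Suc (Suc a)))"
    unfolding renewal_def by (subst sum.atMost_Suc_shift) simp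
  also have "\<dots> = (\<Sum>a\<le>Suc m. real (a choose (Suc m - a)) * (x ^ (Suc m - a) / (1 + x) ^ Suc a) / (1 + x)
      + (if a \<le> m then real (a choose (m - a)) * (x ^ (m - a) / (1 + x) ^ Suc a) * x / (1 + x) else 0))"
  proof (rule sum.cong[OF refl])
    fix a assume "a \<in> {..Suc m}"
    show "real (Suc a choose (Suc m - a)) * (x ^ (Suc m - a) / (1 + x) ^ Suc (Suc a))
      = real (a choose (Suc m - a)) * (x ^ (Suc m - a) / (1 + x) ^ Suc a) / (1 + x)
      + (if a \<le> m then real (a choose (m - a)) * (x ^ (m - a) / (1 + x) ^ Suc a) * x / (1 + x) else 0)"
    proof (cases "a \<le> m")
      case True
      then have "Suc m - a = Suc (m - a)" by simp
      then show ?thesis using True by (simp add: add_divide_distrib algebra_simps)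
    next
      case False
      then have "Suc m - a = 0" by simp
      then show ?thesis using False by (simp add: mult.commute)
    qed
  qed
  also have "\<dots> = renewal (Suc m) x / (1 + x) + renewal m x * x / (1 + x)"
    unfolding sum.distrib
  proof (rule arg_cong2[where f = "(+)"])
    show "(\<Sum>a\<le>Suc m. real (a choose (Suc m - a)) * (x ^ (Suc m - a) / (1 + x) ^ Suc a) / (1 + x))
        = renewal (Suc m) x / (1 + x)"
      unfolding renewal_def sum_divide_distrib ..
    show "(\<Sum>a\<le>Suc m. if a \<le> m then real (a choose (m - a)) * (x ^ (m - a) / (1 + x) ^ Suc a) * x / (1 + x) else 0)
        = renewal m x * x / (1 + x)"
      unfolding renewal_def sum_divide_distrib sum_distrib_right by simp
  qed
  finally show ?thesis by (simp add: add_divide_distrib mult.commute)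
qed

lemma renewal_1: "renewal 1 x = 1 / (1 + x)\<^sup>2"
  by (simp add: renewal_def power2_eq_square)

text \<open>The bound is \<open>renewal 2 x\<close>, and \<open>renewal 1 x\<close> lies below it by
  \<open>x\<^sup>2 / (1 + x) ^ 3\<close>. Index \<open>0\<close> has to stay out, as
  \<open>renewal 0 x = 1 / (1 + x)\<close> is larger for \<open>x > 0\<close>.\<close>

lemma renewal_bounds:
  assumes "x \<ge> 0"
  shows "renewal (Suc m) x \<le> (1 + x + x\<^sup>2) / (1 + x) ^ 3 \<and> renewal (Suc (Suc m)) x \<le> (1 + x + x\<^sup>2) / (1 + x) ^ 3"
proof (induction m)
  case 0
  have "renewal 2 x = (1 + x + x\<^sup>2) / (1 + x) ^ 3"
    using assms by (simp add: renewal_def numeral_2_eq_2 numeral_3_eq_3 divide_simps) (simp add: algebra_simps)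
  moreover have "renewal 1 x \<le> (1 + x + x\<^sup>2) / (1 + x) ^ 3"
    using assms unfolding renewal_1 by (simp add: divide_simps power2_eq_square power3_eq_cube) 
  ultimately show ?case by (simp add: numeral_2_eq_2)
next
  case (Suc m)
  let ?B = "(1 + x + x\<^sup>2) / (1 + x) ^ 3"
  have "renewal (Suc (Suc m)) x + x * renewal (Suc m) x \<le> ?B + x * ?B"
    using Suc assms by (intro add_mono mult_left_mono) auto
  then have "renewal (Suc (Suc (Suc m))) x \<le> (?B + x * ?B) / (1 + x)"
    unfolding renewal_Suc_Suc[of "Suc m"] using assms by (intro divide_right_mono) auto
  also have "?B + x * ?B = ?B * (1 + x)" by (simp only: distrib_left mult_1_right mult.commute[of x])
  finally show ?case using Suc assms by simp
qed

lemma distinct_limit_le: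
  assumes "h \<ge> 2"
  shows "distinct_limit h \<le> ln 2 - 1 / 8"
proof -
  obtain m where h: "h = Suc (Suc m)" using assms by (metis add_2_eq_Suc le_Suc_ex)
  have int: "(\<lambda>x::real. real (a choose (Suc m - a)) * (x ^ (Suc m - a) / (1 + x) ^ Suc a)) integrable_on {0..1}" for a
    by (rule integrable_on_mult_right[OF limit_weight_integrable])
  have eq: "distinct_limit h = integral {0..1} (renewal (Suc m))"
  proof -
    have "distinct_limit h = (\<Sum>a\<le>Suc m. integral {0..1} (\<lambda>x. real (a choose (Suc m - a)) * (x ^ (Suc m - a) / (1 + x) ^ Suc a)))"
      unfolding distinct_limit_def limit_weight_def h lessThan_Suc_atMost integral_mult_right
      by (intro sum.cong refl) (simp only: diff_commute[of _ _ 1] diff_Suc_1 Suc_eq_plus1[symmetric])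
    also have "\<dots> = integral {0..1} (\<lambda>x. \<Sum>a\<le>Suc m. real (a choose (Suc m - a)) * (x ^ (Suc m - a) / (1 + x) ^ Suc a))"
      by (rule integral_sum[symmetric]) (use int in auto)
    finally show ?thesis unfolding renewal_def .
  qed
  have "renewal (Suc m) integrable_on {0..1}"
    unfolding renewal_def using int by (intro integrable_sum) auto
  \<comment> \<open>The antiderivative comes from
    \<open>1 + x + x\<^sup>2 = (1 + x)\<^sup>2 - (1 + x) + 1\<close>. The integral is the value of
    \<open>distinct_limit\<close> at \<open>h = 3\<close>.\<close>
  moreover have hi: "((\<lambda>x::real. (1 + x + x\<^sup>2) / (1 + x) ^ 3) has_integral
     (ln (1 + 1) + 1 / (1 + 1) - 1 / (2 * (1 + 1)\<^sup>2)) - (ln (1 + 0) + 1 / (1 + 0) - 1 / (2 * (1 + 0)\<^sup>2))) {0..1}"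
  proof (rule fundamental_theorem_of_calculus)
    fix x :: real assume "x \<in> {0..1}"
    then have x: "1 + x > 0" by simp
    have "((\<lambda>x. ln (1 + x) + 1 / (1 + x) - 1 / (2 * (1 + x)\<^sup>2)) has_real_derivative
       1 / (1 + x) - 1 / (1 + x)\<^sup>2 + 1 / (1 + x) ^ 3) (at x within {0..1})"
      by (rule derivative_eq_intros refl | use x in force)+
        (use x in \<open>simp add: divide_simps power2_eq_square power3_eq_cube, simp add: algebra_simps\<close>)
    moreover have "1 / (1 + x) - 1 / (1 + x)\<^sup>2 + 1 / (1 + x) ^ 3 = (1 + x + x\<^sup>2) / (1 + x) ^ 3"
      using x by (simp add: divide_simps power2_eq_square power3_eq_cube) (simp add: algebra_simps)
    ultimately show "((\<lambda>x. ln (1 + x) + 1 / (1 + x) - 1 / (2 * (1 + x)\<^sup>2)) has_vector_derivative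
       (1 + x + x\<^sup>2) / (1 + x) ^ 3) (at x within {0..1})"
      by (simp add: has_real_derivative_iff_has_vector_derivative)
  qed simp
  ultimately have "integral {0..1} (renewal (Suc m)) \<le> integral {0..1} (\<lambda>x. (1 + x + x\<^sup>2) / (1 + x) ^ 3)"
    using renewal_bounds by (intro integral_le) (auto simp: integrable_on_def)
  also have "\<dots> = ln 2 - 1 / 8" using integral_unique[OF hi] by simp
  finally show ?thesis using eq by simp
qed

theorem theorem1p2:
  fixes h :: nat
  assumes "h \<ge> 2"
  shows "(\<exists>N::nat. N > 0 \<and> (\<forall>n>N. odd_hooks h n \<ge> distinct_hooks h n)) \<and>
    (\<exists>\<gamma>::real. \<gamma> > 1 \<and>
      (\<lambda>n. real (odd_hooks h n) / real (distinct_hooks h n)) \<longlonglongrightarrow> \<gamma>)"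
proof -
  define \<gamma> where "\<gamma> = odd_limit h / distinct_limit h"
  have pos: "distinct_limit h > 0" using assms by (intro distinct_limit_pos) simp
  \<comment> \<open>The numerical core is \<open>25 / 36 - 1 / 8 = 41 / 72 < 4 / 7\<close>, that is,
    \<open>287 < 288\<close>.\<close>
  have "distinct_limit h < odd_limit h"
    using distinct_limit_le[OF assms] odd_limit_ge[OF assms] ln2_le_25_over_36 by linarith
  then have \<gamma>: "\<gamma> > 1" using pos by (simp add: \<gamma>_def)
  have "(\<lambda>n. (real (odd_hooks h n) / S (int n)) / (real (distinct_hooks h n) / S (int n))) \<longlonglongrightarrow> \<gamma>"
    unfolding \<gamma>_def using pos by (intro tendsto_divide odd_hooks_tendsto distinct_hooks_tendsto) simp
  moreover have "\<forall>\<^sub>F n in sequentially. (real (odd_hooks h n) / S (int n)) / (real (distinct_hooks h n) / S (int n))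
      = real (odd_hooks h n) / real (distinct_hooks h n)"
    using eventually_gt_at_top[of 0]
  proof eventually_elim
    case (elim n)
    then have "S (int n) > 0" by (intro S_pos) simp
    then show ?case by simp
  qed
  ultimately have lim: "(\<lambda>n. real (odd_hooks h n) / real (distinct_hooks h n)) \<longlonglongrightarrow> \<gamma>"
    by (rule Lim_transform_eventually)
  then have "\<forall>\<^sub>F n in sequentially. real (odd_hooks h n) / real (distinct_hooks h n) > 1"
    using \<gamma> by (rule order_tendstoD)
  then obtain N where N: "\<And>n. n \<ge> N \<Longrightarrow> real (odd_hooks h n) / real (distinct_hooks h n) > 1"
    by (auto simp: eventually_sequentially)
  \<comment> \<open>\<open>Suc N\<close> makes the threshold positive. If the denominator is
    \<open>0\<close> the inequality is trivial; otherwise it can be cleared.\<close>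
  have "odd_hooks h n \<ge> distinct_hooks h n" if "n > Suc N" for n
    using N[of n] that by (cases "distinct_hooks h n = 0") (auto simp: field_simps)
  then show ?thesis using lim \<gamma> by blast
qed

end
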